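(* Let $n_1$ be an even positive integer, let $n=2n_1$ and let $r\in\mathbb{Z}_n^*$ be of (multiplicative) order $4$. Let $X$ be one of the two connected components of $M(r;4,n)$. Then $X$ is half-arc-transitive unless $r^2\equiv\pm 1\pmod{n_1}$, in which case $X$ is arc-transitive.
   Context: For integers $m,n$ and $r\in\mathbb{Z}_n^*$ with $r^m=\pm1$, the metacirculant $M(r;m,n)$ is the graph with vertex set $\{u_i^j: i\in\mathbb{Z}_m, j\in\mathbb{Z}_n\}$ and edge set $\{u_i^ju_{i+1}^{j\pm r^i}: i\in\mathbb{Z}_m, j\in\mathbb{Z}_n\}$. When $m=4$, $n\equiv 0\pmod 4$ and $r$ has order $4$ in $\mathbb{Z}_n^*$, $M(r;4,n)$ consists of two isomorphic connected components, one on the vertices $u_i^j$ with $i\equiv j\pmod 2$ and the other on the vertices $u_i^j$ with $i\not\equiv j\pmod 2$. A graph is arc-transitive if its automorphism group acts transitively on arcs (ordered pairs of adjacent vertices), and half-arc-transitive if its automorphism group acts transitively on vertices and on edges but not on arcs. *)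

theory Defs
  imports
    "HOL-Number_Theory.Number_Theory"
    "HOL-Combinatorics.Permutations"
    "Graph_Theory.Graph_Theory"
begin

text \<open>
  Simple undirected graphs are represented, as in \<^theory>\<open>Graph_Theory.Pair_Digraph\<close>, by symmetric
  arc relations: the arcs are the ordered pairs of adjacent vertices, and the edge joining
  \<open>u\<close> and \<open>v\<close> is the pair of arcs \<open>(u, v)\<close>, \<open>(v, u)\<close>.
\<close>

definition edges_of :: "'a pair_pre_digraph \<Rightarrow> 'a set set" where
  "edges_of G = {{u, v} | u v. (u, v) \<in> parcs G}"

definition automorphisms :: "'a pair_pre_digraph \<Rightarrow> ('a \<Rightarrow> 'a) set" where
  "automorphisms G = {f. f permutes pverts G \<and>
     (\<forall>u \<in> pverts G. \<forall>v \<in> pverts G. (f u, f v) \<in> parcs G \<longleftrightarrow> (u, v) \<in> parcs G)}"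

definition vertex_transitive :: "'a pair_pre_digraph \<Rightarrow> bool" where
  "vertex_transitive G \<longleftrightarrow>
     (\<forall>u \<in> pverts G. \<forall>v \<in> pverts G. \<exists>f \<in> automorphisms G. f u = v)"

definition edge_transitive :: "'a pair_pre_digraph \<Rightarrow> bool" where
  "edge_transitive G \<longleftrightarrow>
     (\<forall>e \<in> edges_of G. \<forall>e' \<in> edges_of G. \<exists>f \<in> automorphisms G. f ` e = e')"

definition arc_transitive :: "'a pair_pre_digraph \<Rightarrow> bool" where
  "arc_transitive G \<longleftrightarrow>
     (\<forall>a \<in> parcs G. \<forall>b \<in> parcs G. \<exists>f \<in> automorphisms G. map_prod f f a = b)"

definition half_arc_transitive :: "'a pair_pre_digraph \<Rightarrow> bool" where
  "half_arc_transitive G \<longleftrightarrow>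
     vertex_transitive G \<and> edge_transitive G \<and> \<not> arc_transitive G"

text \<open>For a symmetric graph, the strongly connected components are the connected components.\<close>

definition connected_components :: "'a pair_pre_digraph \<Rightarrow> 'a pair_pre_digraph set" where
  "connected_components G = {X. with_proj X \<in> pre_digraph.sccs (with_proj G)}"

text \<open>
  The vertex \<open>u\<^sub>i\<^sup>j\<close> is the pair \<open>(i, j)\<close> of canonical representatives of the residues \<open>i\<close> modulo
  \<open>m\<close> and \<open>j\<close> modulo \<open>n\<close>.  Reading the exponent of \<open>r\<^sup>i\<close> as the representative of \<open>i\<close> is harmless:
  when \<open>r\<^sup>m = \<plusminus>1\<close> modulo \<open>n\<close>, the pair \<open>\<plusminus>r\<^sup>i\<close> depends only on \<open>i\<close> modulo \<open>m\<close>.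
\<close>

definition metacirculant_steps :: "nat \<Rightarrow> nat \<Rightarrow> nat \<Rightarrow> (nat \<times> int) rel" where
  "metacirculant_steps r m n =
     {((i, j), ((i + 1) mod m, (j + s * int r ^ i) mod int n)) | i j s.
        i \<in> {0..<m} \<and> j \<in> {0..<int n} \<and> s \<in> {1, -1}}"

definition metacirculant :: "nat \<Rightarrow> nat \<Rightarrow> nat \<Rightarrow> (nat \<times> int) pair_pre_digraph" where
  "metacirculant r m n =
     \<lparr> pverts = {0..<m} \<times> {0..<int n},
       parcs = metacirculant_steps r m n \<union> (metacirculant_steps r m n)\<inverse> \<rparr>"

end

theory Submission
  imports Defs
begin

text \<open>
  The maps \<open>(i, j) \<mapsto> (i + a, \<plusminus>r\<^sup>a j + b)\<close> are transitive on the vertices and on the edges, so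
  everything depends on whether an automorphism can reverse an edge.  If \<open>r\<^sup>2 = \<plusminus>1\<close> modulo \<open>n1\<close>,
  then a correction of \<open>(i, j) \<mapsto> (-i, r j)\<close> does.

  Conversely, suppose first that every automorphism preserves, at each vertex, the partition of
  the four neighbours into the two of the next and the two of the previous level.  Then it
  permutes the cycles spanned by two consecutive levels.  If it fixes \<open>(0, 0)\<close> and interchanges
  the two such cycles through it, it acts on the even \<open>j\<close> of level 0 as multiplication by
  \<open>\<plusminus>r\<^sup>3\<close>, read off one cycle, and by \<open>\<plusminus>r\<close>, read off the other, whence \<open>r\<^sup>2 = \<plusminus>1\<close> modulo \<open>n1\<close>.

  If \<open>r\<^sup>2 \<noteq> \<plusminus>1\<close>, write \<open>n1 = k l\<close> with \<open>r\<^sup>2 = 1\<close> modulo \<open>k\<close> and \<open>r\<^sup>2 = -1\<close> modulo \<open>l\<close>, where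
  \<open>k > 2\<close> is even and \<open>l > 1\<close> is odd.  When \<open>r = \<plusminus>1\<close> modulo \<open>k\<close>, there are 4-cycles; opposite
  vertices of 4-cycles form chains, and an automorphism that fixes \<open>(0, 0)\<close> and the next vertex
  of its chain fixes the whole chain and then also \<open>(1, 1)\<close>, so the stabiliser of a vertex is not
  transitive on its neighbours.  Otherwise two neighbours on the same level are told
  apart from two neighbours on different levels by the number of 8-cycles through them, except
  for \<open>n = 80\<close>, where a finer count is needed.  A sign pattern closes up if and only if
  \<open>A + B r = 0\<close> modulo \<open>k\<close> and \<open>a + b r = 0\<close> modulo \<open>l\<close> for small numbers \<open>A, B, a, b\<close>, which leaves
  a finite enumeration.
\<close>

section \<open>Automorphisms\<close>

lemma automorphisms_permutes: "f \<in> automorphisms G \<Longrightarrow> f permutes pverts G"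
  by (simp add: automorphisms_def)

lemma automorphisms_arc_iff:
  "f \<in> automorphisms G \<Longrightarrow> u \<in> pverts G \<Longrightarrow> v \<in> pverts G \<Longrightarrow>
    (f u, f v) \<in> parcs G \<longleftrightarrow> (u, v) \<in> parcs G"
  by (simp add: automorphisms_def)

lemma automorphisms_vert_iff: "f \<in> automorphisms G \<Longrightarrow> f v \<in> pverts G \<longleftrightarrow> v \<in> pverts G"
  by (meson automorphisms_permutes permutes_in_image)

lemma automorphisms_eq_iff: "f \<in> automorphisms G \<Longrightarrow> f u = f v \<longleftrightarrow> u = v"
  by (metis automorphisms_permutes permutes_inj injD)

lemma automorphisms_comp:
  assumes "f \<in> automorphisms G" "g \<in> automorphisms G"
  shows "f \<circ> g \<in> automorphisms G"
  using assms permutes_compose[of g "pverts G" f] permutes_in_image[of g "pverts G"]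
  by (simp add: automorphisms_def)

lemma automorphisms_inv:
  assumes "f \<in> automorphisms G"
  shows "inv_into UNIV f \<in> automorphisms G"
proof -
  note p = automorphisms_permutes[OF assms]
  have "(inv_into UNIV f u, inv_into UNIV f v) \<in> parcs G \<longleftrightarrow> (u, v) \<in> parcs G"
    if "u \<in> pverts G" "v \<in> pverts G" for u v
    using automorphisms_arc_iff[OF assms, of "inv_into UNIV f u" "inv_into UNIV f v"] that
    by (simp add: permutes_in_image[OF permutes_inv[OF p]] permutes_inverses(1)[OF p])
  then show ?thesis using permutes_inv[OF p] by (simp add: automorphisms_def)
qed

lemma automorphisms_inv_eq: "f \<in> automorphisms G \<Longrightarrow> inv_into UNIV f (f v) = v"
  by (metis automorphisms_permutes permutes_inverses(2))

text \<open>A map that is injective on the vertices and preserves arcs is also injective on the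
  finite set of arcs, hence onto it, and so it reflects arcs.\<close>

lemma automorphismI:
  assumes fin: "finite (pverts G)" and ends: "parcs G \<subseteq> pverts G \<times> pverts G"
    and inj: "inj_on f (pverts G)" and into: "f ` pverts G \<subseteq> pverts G"
    and arcs: "\<And>u v. (u, v) \<in> parcs G \<Longrightarrow> (f u, f v) \<in> parcs G"
  shows "(\<lambda>v. if v \<in> pverts G then f v else v) \<in> automorphisms G" (is "?f \<in> _")
proof -
  have bij: "bij_betw f (pverts G) (pverts G)"
    using endo_inj_surj[OF fin into inj] inj by (simp add: bij_betw_def)
  have "?f permutes pverts G"
    by (rule bij_imp_permutes) (use bij in \<open>auto cong: bij_betw_cong\<close>)
  moreover have "(u, v) \<in> parcs G" if uv: "u \<in> pverts G" "v \<in> pverts G" and "(f u, f v) \<in> parcs G" for u v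
  proof -
    have fin': "finite (parcs G)"
      using fin ends by (meson finite_SigmaI rev_finite_subset)
    have inj': "inj_on (map_prod f f) (parcs G)"
      using map_prod_inj_on[OF inj inj] ends by (rule inj_on_subset)
    have "map_prod f f ` parcs G = parcs G"
      using endo_inj_surj[OF fin' _ inj'] arcs by auto
    then have "(f u, f v) \<in> map_prod f f ` parcs G" using that by simp
    then obtain a b where ab: "(a, b) \<in> parcs G" "f a = f u" "f b = f v" by auto
    then have "a = u" "b = v" using uv inj ends by (auto dest: inj_onD)
    then show ?thesis using ab by simp
  qed
  ultimately show ?thesis using arcs by (auto simp: automorphisms_def)
qed

section \<open>A component in coordinates\<close>

text \<open>\<open>r\<close> to the power of the lower of the two levels joined by the step: an edge
  between levels \<open>i\<close> and \<open>i + 1\<close> carries the coefficient of level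
  \<open>i\<close> from either end. The reduction modulo 4 gives a meaning to every integer
  level.\<close>

definition step_coeff :: "int \<Rightarrow> int \<Rightarrow> int \<Rightarrow> int" where
  "step_coeff r d i = r ^ nat ((if d = 1 then i else i - 1) mod 4)"

text \<open>Both coordinates range over all integers, and only equality of vertices reduces them. A
  component of either parity takes this form once its second coordinate is shifted.\<close>

locale metacirculant_component =
  fixes n1 r :: int and X :: "'a pair_pre_digraph" and vtx :: "int \<Rightarrow> int \<Rightarrow> 'a"
  assumes n1_pos: "n1 > 0" and even_n1: "even n1" and r4: "[r ^ 4 = 1] (mod 2 * n1)"
    and vtx_eq_iff: "\<And>i j i' j'. vtx i j = vtx i' j' \<longleftrightarrow> [i = i'] (mod 4) \<and> [j = j'] (mod 2 * n1)"
    and verts: "pverts X = {vtx i j | i j. even (i + j)}"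
    and arcs: "parcs X = {(vtx i j, vtx (i + d) (j + e * step_coeff r d i)) | i j d e.
      even (i + j) \<and> d \<in> {1, -1} \<and> e \<in> {1, -1}}"
begin

abbreviation n where "n \<equiv> 2 * n1"
abbreviation S where "S \<equiv> step_coeff r"

lemma odd_r: "odd r"
proof
  assume "even r"
  then have "2 dvd r ^ 4" by simp
  moreover have "2 dvd r ^ 4 - 1" using r4 by (meson cong_iff_dvd_diff dvd_trans dvd_triv_left)
  ultimately have "2 dvd r ^ 4 - (r ^ 4 - 1)" by (rule dvd_diff)
  then show False by simp
qed

lemma odd_S [simp]: "odd (S d i)"
  using odd_r by (simp add: step_coeff_def)

lemma finite_verts: "finite (pverts X)"
proof -
  have "vtx i j \<in> (\<lambda>(i, j). vtx i j) ` ({0..<4} \<times> {0..<n})" for i j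
  proof -
    have "vtx i j = vtx (i mod 4) (j mod n)" by (simp add: vtx_eq_iff)
    then show ?thesis using n1_pos by (auto intro!: image_eqI[of _ _ "(i mod 4, j mod n)"])
  qed
  then have "pverts X \<subseteq> (\<lambda>(i, j). vtx i j) ` ({0..<4} \<times> {0..<n})"
    unfolding verts by blast
  then show ?thesis by (rule finite_subset) simp
qed

lemma vtx_in_verts: "even (i + j) \<Longrightarrow> vtx i j \<in> pverts X"
  unfolding verts by blast

lemma vtx_arc:
  "even (i + j) \<Longrightarrow> d \<in> {1, -1} \<Longrightarrow> e \<in> {1, -1} \<Longrightarrow>
    (vtx i j, vtx (i + d) (j + e * S d i)) \<in> parcs X"
  unfolding arcs by blast

lemma even_step: "even (i + j) \<Longrightarrow> d \<in> {1, -1} \<Longrightarrow> e \<in> {1, -1} \<Longrightarrow> even (i + d + (j + e * S d i))"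
  by auto

lemma arcs_subset: "parcs X \<subseteq> pverts X \<times> pverts X"
proof
  fix a assume "a \<in> parcs X"
  then obtain i j d e where a: "a = (vtx i j, vtx (i + d) (j + e * S d i))"
    and h: "even (i + j)" "d \<in> {1, -1}" "e \<in> {1, -1}" unfolding arcs by blast
  show "a \<in> pverts X \<times> pverts X"
    unfolding a using vtx_in_verts[OF h(1)] vtx_in_verts[OF even_step[OF h]] by simp
qed

lemma S_cong: "[i = i'] (mod 4) \<Longrightarrow> S d i = S d i'"
proof -
  assume "[i = i'] (mod 4)"
  then have "i mod 4 = i' mod 4" "(i - 1) mod 4 = (i' - 1) mod 4"
    by (simp_all add: cong_def mod_diff_cong)
  then show ?thesis by (cases "d = 1") (simp_all add: step_coeff_def)
qed

lemma S_inverse: "d \<in> {1, -1} \<Longrightarrow> S (- d) (i + d) = S d i"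
  by (auto simp: step_coeff_def)

lemma power_mod_4_add:
  "[r ^ nat ((i + a) mod 4) = r ^ nat (a mod 4) * r ^ nat (i mod 4)] (mod n)"
proof -
  \<comment> \<open>Reducing \<open>i\<close> and \<open>a\<close> modulo 4 separately changes the
    exponent by a multiple of 4, which \<open>r ^ 4 = 1\<close> absorbs.\<close>
  have *: "nat (i mod 4) + nat (a mod 4) = nat ((i + a) mod 4) + 4 * nat ((i mod 4 + a mod 4) div 4)"
  proof -
    have nat_eq: "nat x + nat y = nat z + 4 * nat q"
      if "x + y = z + 4 * q" "x \<ge> 0" "y \<ge> 0" "z \<ge> 0" "q \<ge> 0" for x y z q :: int
    proof -
      have "nat x + nat y = nat (z + 4 * q)" using that by (simp flip: nat_add_distrib)
      also have "\<dots> = nat z + 4 * nat q" using that by (simp add: nat_add_distrib nat_mult_distrib)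
      finally show ?thesis .
    qed
    show ?thesis
    proof (rule nat_eq)
      show "i mod 4 + a mod 4 = (i + a) mod 4 + 4 * ((i mod 4 + a mod 4) div 4)"
        by (metis add.commute mod_add_eq mult_div_mod_eq)
      show "(i mod 4 + a mod 4) div 4 \<ge> 0"
        by (rule iffD2[OF pos_imp_zdiv_nonneg_iff]) (auto intro: add_nonneg_nonneg)
    qed simp_all
  qed
  have "r ^ nat (a mod 4) * r ^ nat (i mod 4) = r ^ (nat (i mod 4) + nat (a mod 4))"
    by (simp add: power_add)
  also have "\<dots> = r ^ nat ((i + a) mod 4) * (r ^ 4) ^ nat ((i mod 4 + a mod 4) div 4)"
    unfolding * by (simp add: power_add power_mult)
  also have "[\<dots> = r ^ nat ((i + a) mod 4) * 1 ^ nat ((i mod 4 + a mod 4) div 4)] (mod n)"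
    by (intro cong_mult cong_pow r4 cong_refl)
  finally show ?thesis by (simp add: cong_sym_eq)
qed

lemma S_add: "[S d (i + a) = r ^ nat (a mod 4) * S d i] (mod n)"
  unfolding step_coeff_def using power_mod_4_add[of i a] power_mod_4_add[of "i - 1" a]
  by (simp add: algebra_simps)

lemma neighbours:
  assumes "even (i + j)"
  shows "(vtx i j, w) \<in> parcs X \<longleftrightarrow> (\<exists>d\<in>{1, -1}. \<exists>e\<in>{1, -1}. w = vtx (i + d) (j + e * S d i))"
proof
  assume "(vtx i j, w) \<in> parcs X"
  then obtain i' j' d e where h: "vtx i j = vtx i' j'" "w = vtx (i' + d) (j' + e * S d i')"
    "d \<in> {1, -1}" "e \<in> {1, -1}" unfolding arcs by blast
  from h(1) have c: "[i = i'] (mod 4)" "[j = j'] (mod n)" by (auto simp: vtx_eq_iff)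
  have "w = vtx (i + d) (j + e * S d i)"
    unfolding h(2) vtx_eq_iff S_cong[OF c(1), of d]
    by (intro conjI cong_add cong_sym[OF c(1)] cong_sym[OF c(2)] cong_refl)
  then show "\<exists>d\<in>{1, -1}. \<exists>e\<in>{1, -1}. w = vtx (i + d) (j + e * S d i)" using h by blast
next
  assume "\<exists>d\<in>{1, -1}. \<exists>e\<in>{1, -1}. w = vtx (i + d) (j + e * S d i)"
  then show "(vtx i j, w) \<in> parcs X" using vtx_arc[OF assms] by blast
qed

text \<open>Assumption \<open>eq\<close>, read from left to right, makes the map independent of the
  chosen coordinates; read from right to left, it makes the map injective. Finiteness does the
  rest.\<close>

lemma automorphism_of_coords:
  assumes even: "\<And>i j. even (i + j) \<Longrightarrow> even (F i + G i j)"
    and eq: "\<And>i j i' j'. vtx i j = vtx i' j' \<longleftrightarrow> vtx (F i) (G i j) = vtx (F i') (G i' j')"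
    and arc: "\<And>i j d e. even (i + j) \<Longrightarrow> d \<in> {1, -1} \<Longrightarrow> e \<in> {1, -1} \<Longrightarrow>
      (vtx (F i) (G i j), vtx (F (i + d)) (G (i + d) (j + e * S d i))) \<in> parcs X"
  obtains f where "f \<in> automorphisms X" "\<And>i j. even (i + j) \<Longrightarrow> f (vtx i j) = vtx (F i) (G i j)"
proof -
  define f0 where "f0 v = (SOME w. \<exists>i j. even (i + j) \<and> v = vtx i j \<and> w = vtx (F i) (G i j))" for v
  have f0: "f0 (vtx i j) = vtx (F i) (G i j)" if "even (i + j)" for i j
    unfolding f0_def
  proof (rule some_equality)
    show "\<exists>i' j'. even (i' + j') \<and> vtx i j = vtx i' j' \<and> vtx (F i) (G i j) = vtx (F i') (G i' j')"
      using that by blast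
    show "w = vtx (F i) (G i j)"
      if "\<exists>i' j'. even (i' + j') \<and> vtx i j = vtx i' j' \<and> w = vtx (F i') (G i' j')" for w
    proof -
      from that obtain i' j' where "vtx i j = vtx i' j'" "w = vtx (F i') (G i' j')" by blast
      then show ?thesis using eq[of i j i' j'] by simp
    qed
  qed
  have 1: "inj_on f0 (pverts X)"
  proof (rule inj_onI)
    fix u v assume "u \<in> pverts X" "v \<in> pverts X" and uv: "f0 u = f0 v"
    then obtain i j i' j' where h: "u = vtx i j" "even (i + j)" "v = vtx i' j'" "even (i' + j')"
      unfolding verts by blast
    then show "u = v" using uv eq[of i j i' j'] by (simp add: f0)
  qed
  have 2: "f0 ` pverts X \<subseteq> pverts X"
  proof
    fix w assume "w \<in> f0 ` pverts X"
    then obtain i j where "w = f0 (vtx i j)" "even (i + j)" unfolding verts by blast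
    then show "w \<in> pverts X" using f0 vtx_in_verts[OF even] by simp
  qed
  have 3: "(f0 u, f0 v) \<in> parcs X" if "(u, v) \<in> parcs X" for u v
  proof -
    from that obtain i j d e where h: "u = vtx i j" "v = vtx (i + d) (j + e * S d i)"
      "even (i + j)" "d \<in> {1, -1}" "e \<in> {1, -1}" unfolding arcs by blast
    show ?thesis unfolding h(1,2) f0[OF h(3)] f0[OF even_step[OF h(3-5)]] by (rule arc[OF h(3-5)])
  qed
  show ?thesis
  proof (rule that)
    show "(\<lambda>v. if v \<in> pverts X then f0 v else v) \<in> automorphisms X"
      by (rule automorphismI[OF finite_verts arcs_subset 1 2 3])
  qed (simp add: vtx_in_verts f0)
qed

lemma arcI:
  assumes "even (i + j)" "d \<in> {1, -1}" "e \<in> {1, -1}" "[i' = i + d] (mod 4)" "[j' = j + e * S d i] (mod n)"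
  shows "(vtx i j, vtx i' j') \<in> parcs X"
proof -
  have "vtx i' j' = vtx (i + d) (j + e * S d i)" using assms(4,5) by (simp add: vtx_eq_iff)
  then show ?thesis using vtx_arc[OF assms(1-3)] by simp
qed

lemma power_mod_4_unit: "coprime (r ^ k) n"
proof -
  have "coprime (r ^ 4) n" using r4 by (metis cong_imp_coprime cong_sym coprime_1_left)
  then show ?thesis by (simp add: coprime_power_left_iff)
qed

text \<open>Going up by \<open>a\<close> levels multiplies all step coefficients by
  \<open>r ^ a\<close> modulo \<open>n\<close>, and multiplication of the second coordinate matches
  this; \<open>s\<close> only changes the signs of the steps.\<close>

lemma rotation:
  assumes ab: "even (a + b)" and s: "s \<in> {1, -1}"
  obtains f where "f \<in> automorphisms X"
    "\<And>i j. even (i + j) \<Longrightarrow> f (vtx i j) = vtx (i + a) (s * r ^ nat (a mod 4) * j + b)"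
proof (rule automorphism_of_coords[of "\<lambda>i. i + a" "\<lambda>i j. s * r ^ nat (a mod 4) * j + b"])
  let ?R = "r ^ nat (a mod 4)"
  show ev: "even (i + a + (s * ?R * j + b))" if "even (i + j)" for i j
    using that ab s odd_r by auto
  have cop: "coprime (s * ?R) n" using power_mod_4_unit s by auto
  show "vtx i j = vtx i' j' \<longleftrightarrow> vtx (i + a) (s * ?R * j + b) = vtx (i' + a) (s * ?R * j' + b)" for i j i' j'
    by (simp only: vtx_eq_iff cong_add_rcancel cong_mult_lcancel[OF cop])
  show "(vtx (i + a) (s * ?R * j + b), vtx (i + d + a) (s * ?R * (j + e * S d i) + b)) \<in> parcs X"
    if h: "even (i + j)" "d \<in> {1, -1}" "e \<in> {1, -1}" for i j d e
  proof (rule arcI[OF ev[OF h(1)] h(2), where e = "s * e"])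
    show "s * e \<in> {1, -1}" using h s by auto
    show "[i + d + a = i + a + d] (mod 4)" by (simp add: algebra_simps)
    have "[s * ?R * j + b + s * e * (?R * S d i) = s * ?R * j + b + s * e * S d (i + a)] (mod n)"
      by (intro cong_add cong_mult cong_refl cong_sym[OF S_add])
    then show "[s * ?R * (j + e * S d i) + b = s * ?R * j + b + s * e * S d (i + a)] (mod n)"
      by (simp add: algebra_simps)
  qed
next
  fix f assume "f \<in> automorphisms X"
    "\<And>i j. even (i + j) \<Longrightarrow> f (vtx i j) = vtx (i + a) (s * r ^ nat (a mod 4) * j + b)"
  then show thesis by (rule that)
qed

end

section \<open>Transitivity on vertices and edges, and the reversal of edges\<close>

context metacirculant_component
begin

lemma S_simps [simp]: "S 1 0 = 1" "S (-1) 1 = 1" "S (-1) 0 = r ^ 3" "S 1 (-1) = r ^ 3"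
  "S 1 1 = r" "S (-1) 2 = r" "S 1 2 = r ^ 2" "S (-1) 3 = r ^ 2" "S 1 3 = r ^ 3"
  by (simp_all add: step_coeff_def)

lemma neighbours_base:
  "(vtx 0 0, w) \<in> parcs X \<longleftrightarrow> (\<exists>d\<in>{1, -1}. \<exists>e\<in>{1, -1}. w = vtx d (e * S d 0))"
proof -
  have "even (0 + 0 :: int)" by simp
  from neighbours[OF this] show ?thesis by (simp only: add_0)
qed

lemma rotation_S:
  assumes "[S d (i + a) = r ^ nat (a mod 4) * S d i] (mod n)"
  shows "vtx (i + a + d) (s * r ^ nat (a mod 4) * (j + e * S d i) + b) =
    vtx (i + a + d) (s * r ^ nat (a mod 4) * j + b + s * e * S d (i + a))"
proof -
  have "[s * r ^ nat (a mod 4) * j + b + s * e * (r ^ nat (a mod 4) * S d i) =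
      s * r ^ nat (a mod 4) * j + b + s * e * S d (i + a)] (mod n)"
    by (intro cong_add cong_mult cong_refl cong_sym[OF assms])
  then show ?thesis by (simp add: vtx_eq_iff algebra_simps)
qed

text \<open>Rotations in the form in which they act on the base vertex and its four neighbours;
  \<open>s\<close> is free to match a sign.\<close>

lemma rotation_base:
  assumes ab: "even (a + b)" and s: "s \<in> {1, -1}"
  obtains f where "f \<in> automorphisms X" "f (vtx 0 0) = vtx a b"
    "\<And>d e. d \<in> {1, -1} \<Longrightarrow> e \<in> {1, -1} \<Longrightarrow> f (vtx d (e * S d 0)) = vtx (a + d) (b + s * e * S d a)"
proof -
  obtain f where f: "f \<in> automorphisms X"
    "\<And>i j. even (i + j) \<Longrightarrow> f (vtx i j) = vtx (i + a) (s * r ^ nat (a mod 4) * j + b)"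
    using rotation[OF ab s] by blast
  show ?thesis
  proof (rule that[OF f(1)])
    show "f (vtx 0 0) = vtx a b" using f(2)[of 0 0] by simp
    fix d e :: int assume h: "d \<in> {1, -1}" "e \<in> {1, -1}"
    have "f (vtx d (e * S d 0)) = vtx (d + a) (s * r ^ nat (a mod 4) * (e * S d 0) + b)"
      by (rule f(2)) (use even_step[OF _ h, of 0 0] in simp)
    also have "\<dots> = vtx (a + d) (b + s * e * S d a)"
      using rotation_S[OF S_add, of 0 a d s 0 e b] by (simp add: algebra_simps)
    finally show "f (vtx d (e * S d 0)) = vtx (a + d) (b + s * e * S d a)" .
  qed
qed

lemma vertex_transitive: "vertex_transitive X"
  unfolding vertex_transitive_def
proof (intro ballI)
  fix u v assume "u \<in> pverts X" "v \<in> pverts X"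
  then obtain i j i' j' where h: "u = vtx i j" "even (i + j)" "v = vtx i' j'" "even (i' + j')"
    unfolding verts by blast
  obtain f where f: "f \<in> automorphisms X" "f (vtx 0 0) = vtx i j"
    by (rule rotation_base[OF h(2), of 1]) auto
  obtain g where g: "g \<in> automorphisms X" "g (vtx 0 0) = vtx i' j'"
    by (rule rotation_base[OF h(4), of 1]) auto
  have "(g \<circ> inv_into UNIV f) u = v"
    using automorphisms_inv_eq[OF f(1), of "vtx 0 0"] by (simp add: h f(2) g(2))
  then show "\<exists>f\<in>automorphisms X. f u = v"
    using automorphisms_comp[OF g(1) automorphisms_inv[OF f(1)]] by blast
qed

text \<open>A downward arc is an upward arc read from its other end, so a rotation carries the base
  edge onto either kind, in reversed direction for a downward arc.\<close>

lemma up_arc: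
  assumes "(u, v) \<in> parcs X"
  obtains f where "f \<in> automorphisms X" "{f (vtx 0 0), f (vtx 1 1)} = {u, v}"
    "(u, v) = (f (vtx 0 0), f (vtx 1 1)) \<or> (u, v) = (f (vtx 1 1), f (vtx 0 0))"
proof -
  obtain i j d e where h: "u = vtx i j" "v = vtx (i + d) (j + e * S d i)" "even (i + j)"
    "d \<in> {1, -1}" "e \<in> {1, -1}" using assms unfolding arcs by blast
  show ?thesis
  proof (cases "d = 1")
    case True
    obtain f where f: "f \<in> automorphisms X" "f (vtx 0 0) = vtx i j"
      "\<And>d' e'. d' \<in> {1, -1} \<Longrightarrow> e' \<in> {1, -1} \<Longrightarrow> f (vtx d' (e' * S d' 0)) = vtx (i + d') (j + e * e' * S d' i)"
      using rotation_base[OF h(3,5)] by blast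
    have "f (vtx 1 1) = v" using f(3)[of 1 1] True by (simp add: h(2))
    then show ?thesis using that[OF f(1)] f(2) h(1) by simp
  next
    case False
    then have d: "d = -1" using h(4) by simp
    \<comment> \<open>The rotation starts from the lower end \<open>v\<close>; the step back up to
      \<open>u\<close> has the opposite sign.\<close>
    have ev: "even (i + d + (j + e * S d i))" by (rule even_step[OF h(3-5)])
    have me: "- e \<in> {1, -1}" using h(5) by auto
    obtain f where f: "f \<in> automorphisms X" "f (vtx 0 0) = v"
      "\<And>d' e'. d' \<in> {1, -1} \<Longrightarrow> e' \<in> {1, -1} \<Longrightarrow>
        f (vtx d' (e' * S d' 0)) = vtx (i + d + d') (j + e * S d i + - e * e' * S d' (i + d))"
      using rotation_base[OF ev me] h(2) by metis
    have "f (vtx 1 1) = u" using f(3)[of 1 1] S_inverse[of d i] d by (simp add: h(1))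
    then show ?thesis using that[OF f(1)] f(2) by auto
  qed
qed

lemma edge_transitive: "edge_transitive X"
  unfolding edge_transitive_def
proof (intro ballI)
  fix e e' assume "e \<in> edges_of X" "e' \<in> edges_of X"
  then obtain u v u' v' where h: "e = {u, v}" "(u, v) \<in> parcs X" "e' = {u', v'}" "(u', v') \<in> parcs X"
    unfolding edges_of_def by blast
  obtain f where f: "f \<in> automorphisms X" "{f (vtx 0 0), f (vtx 1 1)} = e"
    using up_arc[OF h(2)] h(1) by metis
  obtain g where g: "g \<in> automorphisms X" "{g (vtx 0 0), g (vtx 1 1)} = e'"
    using up_arc[OF h(4)] h(3) by metis
  have "(g \<circ> inv_into UNIV f) ` e = e'"
    by (simp add: automorphisms_inv_eq[OF f(1)] g(2) flip: f(2))
  then show "\<exists>f\<in>automorphisms X. f ` e = e'"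
    using automorphisms_comp[OF g(1) automorphisms_inv[OF f(1)]] by blast
qed

text \<open>Every arc is an image of the base arc or of its reverse, and an automorphism that
  reverses the base arc merges the two classes.\<close>

lemma arc_transitiveI:
  assumes k: "k \<in> automorphisms X" "k (vtx 0 0) = vtx 1 1" "k (vtx 1 1) = vtx 0 0"
  shows "arc_transitive X"
proof -
  have base: "\<exists>f\<in>automorphisms X. a = (f (vtx 0 0), f (vtx 1 1))" if "a \<in> parcs X" for a
  proof -
    obtain u v where a: "a = (u, v)" by (cases a)
    have uv: "(u, v) \<in> parcs X" using that by (simp add: a)
    obtain f where f: "f \<in> automorphisms X"
      "(u, v) = (f (vtx 0 0), f (vtx 1 1)) \<or> (u, v) = (f (vtx 1 1), f (vtx 0 0))"
      using up_arc[OF uv] by blast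
    from f(2) show ?thesis
    proof
      assume "(u, v) = (f (vtx 1 1), f (vtx 0 0))"
      then have "a = ((f \<circ> k) (vtx 0 0), (f \<circ> k) (vtx 1 1))" by (simp add: a k)
      then show ?thesis using automorphisms_comp[OF f(1) k(1)] by blast
    qed (use f(1) a in blast)
  qed
  show ?thesis unfolding arc_transitive_def
  proof (intro ballI)
    fix a b assume "a \<in> parcs X" "b \<in> parcs X"
    then obtain f g where fg: "f \<in> automorphisms X" "a = (f (vtx 0 0), f (vtx 1 1))"
      "g \<in> automorphisms X" "b = (g (vtx 0 0), g (vtx 1 1))" using base by metis
    have "map_prod (g \<circ> inv_into UNIV f) (g \<circ> inv_into UNIV f) a = b"
      by (simp add: fg(2,4) automorphisms_inv_eq[OF fg(1)])
    then show "\<exists>f\<in>automorphisms X. map_prod f f a = b"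
      using automorphisms_comp[OF fg(3) automorphisms_inv[OF fg(1)]] by blast
  qed
qed

text \<open>
  Reversing the levels by \<open>(i, j) \<mapsto> (-i, r j)\<close> turns the coefficient \<open>r\<^sup>i\<close> into \<open>r\<^sup>i\<^sup>+\<^sup>2\<close>.  If
  \<open>r\<^sup>2 = \<plusminus>1\<close> holds only modulo \<open>n1\<close>, the two differ by \<open>n1\<close> on half of the levels, and this
  is compensated by shifting the levels 1 and 2.
\<close>

lemma reversal:
  assumes s: "s \<in> {1, -1}" and r2: "[r ^ 2 = s] (mod n1)"
  obtains k where "k \<in> automorphisms X" "\<And>i j. even (i + j) \<Longrightarrow>
    k (vtx i j) = vtx (- i) (r * j + (if i mod 4 \<in> {1, 2} then r ^ 3 - s * r else 0))"
proof -
  \<comment> \<open>This is \<open>r * (r ^ 2 - s)\<close>, a multiple of \<open>n1\<close>; so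
    \<open>2 * \<delta>\<close> vanishes modulo \<open>n\<close>, and \<open>\<delta>\<close> and
    \<open>- \<delta>\<close> are interchangeable.\<close>
  define \<delta> where "\<delta> = r ^ 3 - s * r"
  define c where "c i = (if i mod 4 \<in> {1, 2} then \<delta> else 0)" for i :: int
  have "n1 dvd r * (r ^ 2 - s)" using r2 by (simp add: cong_iff_dvd_diff)
  then have "n1 dvd \<delta>" by (simp add: \<delta>_def algebra_simps power2_eq_square power3_eq_cube)
  then have \<delta>2: "n dvd 2 * \<delta>" by simp
  have ev\<delta>: "even \<delta>" using odd_r s by (auto simp: \<delta>_def)
  have r6: "n dvd r ^ 4 - 1" using r4 by (simp add: cong_iff_dvd_diff)
  have cop: "coprime r n" using power_mod_4_unit[of 1] by simp
  have c_cong: "c i = c i'" if "[i = i'] (mod 4)" for i i'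
    using that by (simp add: c_def cong_def)
  have ev: "even (- i + (r * j + c i))" if "even (i + j)" for i j
    using that odd_r ev\<delta> by (auto simp: c_def)
  have main: "\<exists>e'\<in>{1, -1}. n dvd (r * (e * S d i) + c (i + d) - c i) - e' * S (- d) (- i)"
    if h: "d \<in> {1, -1}" "e \<in> {1, -1}" for i d e
  proof -
    define m where "m = i mod 4"
    have m: "m \<in> {0, 1, 2, 3}" unfolding m_def by auto
    have im: "[i = m] (mod 4)" by (simp add: m_def)
    have S1: "S d i = S d m" by (rule S_cong[OF im])
    have S2: "S (- d) (- i) = S (- d) (- m)" by (rule S_cong) (use im in \<open>simp add: cong_minus_minus_iff\<close>)
    have c1: "c (i + d) = c (m + d)" by (rule c_cong) (use im in \<open>simp add: cong_add_rcancel\<close>)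
    have c2: "c i = c m" by (rule c_cong[OF im])
    have es: "n dvd (1 - e * s) * \<delta>" "n dvd (e * s - 1) * \<delta>"
      using h(2) s \<delta>2 by (auto simp: algebra_simps)
    have r4e: "n dvd e * r ^ 4 - e"
    proof -
      have "n dvd e * (r ^ 4 - 1)" using r6 by simp
      then show ?thesis by (simp add: algebra_simps)
    qed
    have ss: "e * s * s = e" "e * e = 1" using s h(2) by auto
    have e': "e * s \<in> {1, -1}" using s h(2) by auto
    note simps = c_def step_coeff_def power2_eq_square power3_eq_cube power4_eq_xxxx
    consider "m = 0" "d = 1" | "m = 0" "d = -1" | "m = 1" "d = 1" | "m = 1" "d = -1"
      | "m = 2" "d = 1" | "m = 2" "d = -1" | "m = 3" "d = 1" | "m = 3" "d = -1"
      using m h(1) by auto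
    \<comment> \<open>Between levels 0 and 1 and between levels 2 and 3 the shift \<open>c\<close>
      changes by \<open>\<delta>\<close>, and the new sign is \<open>e * s\<close>. Between levels 1
      and 2 and between levels 3 and 0 the shift is constant, and the sign stays
      \<open>e\<close>.\<close>
    then have "\<exists>e'\<in>{1, -1}. n dvd r * (e * S d m) + c (m + d) - c m - e' * S (- d) (- m)"
    proof cases
      case 1
      have "r * (e * S d m) + c (m + d) - c m - e * s * S (- d) (- m) = (1 - e * s) * \<delta>"
        unfolding 1 using ss s by (auto simp: \<delta>_def simps algebra_simps)
      then show ?thesis using es(1) by (intro bexI[OF _ e']) simp
    next
      case 2
      have "r * (e * S d m) + c (m + d) - c m - e * S (- d) (- m) = e * r ^ 4 - e"
        unfolding 2 by (simp add: simps algebra_simps)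
      then show ?thesis using r4e by (intro bexI[OF _ h(2)]) simp
    next
      case 3
      have "r * (e * S d m) + c (m + d) - c m - e * S (- d) (- m) = 0"
        unfolding 3 by (simp add: simps algebra_simps)
      then show ?thesis by (intro bexI[OF _ h(2)]) simp
    next
      case 4
      have "r * (e * S d m) + c (m + d) - c m - e * s * S (- d) (- m) = (- 1 - e * s) * \<delta>"
        unfolding 4 using ss s by (auto simp: \<delta>_def simps algebra_simps)
      moreover have "n dvd (- 1 - e * s) * \<delta>" using h(2) s \<delta>2 by (auto simp: algebra_simps)
      ultimately show ?thesis by (intro bexI[OF _ e']) simp
    next
      case 5
      have "r * (e * S d m) + c (m + d) - c m - e * s * S (- d) (- m) = (e - 1) * \<delta>"
        unfolding 5 using ss s by (auto simp: \<delta>_def simps algebra_simps)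
      moreover have "n dvd (e - 1) * \<delta>" using h(2) \<delta>2 by (auto simp: algebra_simps)
      ultimately show ?thesis by (intro bexI[OF _ e']) simp
    next
      case 6
      have "r * (e * S d m) + c (m + d) - c m - e * S (- d) (- m) = 0"
        unfolding 6 by (simp add: simps algebra_simps)
      then show ?thesis by (intro bexI[OF _ h(2)]) simp
    next
      case 7
      have "r * (e * S d m) + c (m + d) - c m - e * S (- d) (- m) = e * r ^ 4 - e"
        unfolding 7 by (simp add: simps algebra_simps)
      then show ?thesis using r4e by (intro bexI[OF _ h(2)]) simp
    next
      case 8
      have "r * (e * S d m) + c (m + d) - c m - e * s * S (- d) (- m) = (e + 1) * \<delta>"
        unfolding 8 using ss s by (auto simp: \<delta>_def simps algebra_simps)
      moreover have "n dvd (e + 1) * \<delta>" using h(2) \<delta>2 by (auto simp: algebra_simps)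
      ultimately show ?thesis by (intro bexI[OF _ e']) simp
    qed
    then show ?thesis unfolding S1 S2 c1 c2 by (simp add: algebra_simps)
  qed
  show ?thesis
  proof (rule automorphism_of_coords[of uminus "\<lambda>i j. r * j + c i"])
    show "even (- i + (r * j + c i))" if "even (i + j)" for i j by (rule ev[OF that])
    show "vtx i j = vtx i' j' \<longleftrightarrow> vtx (- i) (r * j + c i) = vtx (- i') (r * j' + c i')" for i j i' j'
    proof (cases "[i = i'] (mod 4)")
      case True
      then show ?thesis using c_cong[OF True]
        by (simp only: vtx_eq_iff cong_add_rcancel cong_mult_lcancel[OF cop] cong_minus_minus_iff)
    next
      case False
      then show ?thesis by (simp only: vtx_eq_iff cong_minus_minus_iff simp_thms)
    qed
    show "(vtx (- i) (r * j + c i), vtx (- (i + d)) (r * (j + e * S d i) + c (i + d))) \<in> parcs X"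
      if h: "even (i + j)" "d \<in> {1, -1}" "e \<in> {1, -1}" for i j d e
    proof -
      obtain e' where e': "e' \<in> {1, -1}" "n dvd (r * (e * S d i) + c (i + d) - c i) - e' * S (- d) (- i)"
        using main[OF h(2,3)] by blast
      show ?thesis
      proof (rule arcI[OF ev[OF h(1)] _ e'(1)])
        show "- d \<in> {1, -1}" using h(2) by auto
        show "[- (i + d) = - i + - d] (mod 4)" by simp
        show "[r * (j + e * S d i) + c (i + d) = r * j + c i + e' * S (- d) (- i)] (mod n)"
          using e'(2) by (simp add: cong_iff_dvd_diff algebra_simps)
      qed
    qed
  next
    fix f assume "f \<in> automorphisms X"
      "\<And>i j. even (i + j) \<Longrightarrow> f (vtx i j) = vtx (- i) (r * j + c i)"
    then show thesis using that unfolding c_def \<delta>_def by blast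
  qed
qed

lemma arc_transitive_if:
  assumes "s \<in> {1, -1}" "[r ^ 2 = s] (mod n1)"
  shows "arc_transitive X"
proof -
  obtain k where k: "k \<in> automorphisms X" "\<And>i j. even (i + j) \<Longrightarrow>
    k (vtx i j) = vtx (- i) (r * j + (if i mod 4 \<in> {1, 2} then r ^ 3 - s * r else 0))"
    using reversal[OF assms] by blast
  obtain g where g: "g \<in> automorphisms X" "g (vtx 0 0) = vtx 1 1"
    "\<And>d e. d \<in> {1, -1} \<Longrightarrow> e \<in> {1, -1} \<Longrightarrow> g (vtx d (e * S d 0)) = vtx (1 + d) (1 + 1 * e * S d 1)"
    by (rule rotation_base[of 1 1 1]) auto
  have k0: "k (vtx 0 0) = vtx 0 0" using k(2)[of 0 0] by simp
  have k1: "(vtx 0 0, k (vtx 1 1)) \<in> parcs X"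
    using automorphisms_arc_iff[OF k(1), of "vtx 0 0" "vtx 1 1"] vtx_arc[of 0 0 1 1]
      vtx_in_verts[of 0 0] vtx_in_verts[of 1 1] by (simp add: k0)
  have k1': "k (vtx 1 1) = vtx (- 1) (r * 1 + (r ^ 3 - s * r))" using k(2)[of 1 1] by simp
  obtain d e where de: "d \<in> {1, -1}" "e \<in> {1, -1}" "k (vtx 1 1) = vtx d (e * S d 0)"
    using k1 unfolding neighbours_base by blast
  have "[- 1 = d] (mod 4)" using k1' de(3) vtx_eq_iff by metis
  then have d: "d = -1" using de(1) by (auto simp: cong_def)
  \<comment> \<open>The sign of \<open>h\<close> is chosen such that \<open>h \<circ> k\<close>
    sends \<open>vtx 1 1\<close> to \<open>vtx (-1) (- (r ^ 3))\<close>, the neighbour that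
    \<open>g\<close> carries to \<open>vtx 0 0\<close>.\<close>
  have "- e \<in> {1, -1}" using de by auto
  then obtain h where h: "h \<in> automorphisms X" "h (vtx 0 0) = vtx 0 0"
    "\<And>d' e'. d' \<in> {1, -1} \<Longrightarrow> e' \<in> {1, -1} \<Longrightarrow> h (vtx d' (e' * S d' 0)) = vtx (0 + d') (0 + - e * e' * S d' 0)"
    using rotation_base[of 0 0 "- e"] by auto
  have hk: "h (k (vtx 1 1)) = vtx (-1) (- 1 * S (-1) 0)"
    using h(3)[OF de(1,2)] de(2) by (auto simp: de(3) d)
  show ?thesis
  proof (rule arc_transitiveI)
    show "g \<circ> (h \<circ> k) \<in> automorphisms X" by (intro automorphisms_comp g(1) h(1) k(1))
    show "(g \<circ> (h \<circ> k)) (vtx 0 0) = vtx 1 1" by (simp add: k0 h(2) g(2))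
    show "(g \<circ> (h \<circ> k)) (vtx 1 1) = vtx 0 0"
      using g(3)[of "-1" "-1"] by (simp add: hk)
  qed
qed

end

context metacirculant_component
begin

section \<open>Automorphisms that preserve the sides of every vertex\<close>

text \<open>The two neighbours of \<open>v\<close> on one adjacent level; the opposite signs make
  them distinct.\<close>

definition same_side :: "'a \<Rightarrow> 'a \<Rightarrow> 'a \<Rightarrow> bool" where
  "same_side v x y \<longleftrightarrow> (\<exists>i j. \<exists>d\<in>{1, -1}. \<exists>e\<in>{1, -1}. even (i + j) \<and> v = vtx i j \<and>
    x = vtx (i + d) (j + e * S d i) \<and> y = vtx (i + d) (j - e * S d i))"

lemma S_unit: "coprime (S d i) n"
  unfolding step_coeff_def by (rule power_mod_4_unit)

lemma n1_ge_2: "n1 \<ge> 2"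
  using n1_pos even_n1 by presburger

text \<open>The unit \<open>S d i\<close> cancels, and \<open>n\<close> is at least 4 while two
  signs differ by at most 2.\<close>

lemma sign_eqI:
  assumes "e \<in> {1, -1}" "e' \<in> {1, -1}" "[e * S d i = e' * S d i] (mod n)"
  shows "e = e'"
proof -
  have "n dvd e - e'"
    using assms(3) cong_mult_rcancel[OF S_unit] by (metis cong_iff_dvd_diff)
  show "e = e'"
  proof (rule ccontr)
    assume "e \<noteq> e'"
    then have "\<bar>n\<bar> \<le> \<bar>e - e'\<bar>" by (intro dvd_imp_le_int \<open>n dvd e - e'\<close>) simp
    moreover have "\<bar>e - e'\<bar> \<le> 2" using assms(1,2) by auto
    ultimately show False using n1_ge_2 by linarith
  qed
qed

lemma dir_eqI:
  assumes "d \<in> {1, -1}" "d' \<in> {1, -1}" "[d = d'] (mod (4::int))"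
  shows "d = d'"
  using assms by (auto simp: cong_def)

lemma step_eq_iff:
  assumes "d \<in> {1, -1}" "e \<in> {1, -1}" "d' \<in> {1, -1}" "e' \<in> {1, -1}"
  shows "vtx (i + d) (j + e * S d i) = vtx (i + d') (j + e' * S d' i) \<longleftrightarrow> d = d' \<and> e = e'"
proof
  assume "vtx (i + d) (j + e * S d i) = vtx (i + d') (j + e' * S d' i)"
  then have c: "[d = d'] (mod 4)" "[e * S d i = e' * S d' i] (mod n)"
    by (simp_all add: vtx_eq_iff cong_add_lcancel)
  have "d = d'" by (rule dir_eqI[OF assms(1,3) c(1)])
  moreover from this have "e = e'" using sign_eqI[OF assms(2,4)] c(2) by simp
  ultimately show "d = d' \<and> e = e'" by simp
qed simp

lemma same_side_iff:
  assumes "even (i + j)" "d \<in> {1, -1}" "e \<in> {1, -1}"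
  shows "same_side (vtx i j) (vtx (i + d) (j + e * S d i)) y \<longleftrightarrow> y = vtx (i + d) (j - e * S d i)"
proof
  assume "same_side (vtx i j) (vtx (i + d) (j + e * S d i)) y"
  then obtain i' j' d' e' where h: "d' \<in> {1, -1}" "e' \<in> {1, -1}" "vtx i j = vtx i' j'"
    "vtx (i + d) (j + e * S d i) = vtx (i' + d') (j' + e' * S d' i')" "y = vtx (i' + d') (j' - e' * S d' i')"
    unfolding same_side_def by blast
  from h(3) have c: "[i = i'] (mod 4)" "[j = j'] (mod n)" by (simp_all add: vtx_eq_iff)
  have move: "vtx (i' + d') (j' + f * S d' i') = vtx (i + d') (j + f * S d' i)" for f
    unfolding vtx_eq_iff S_cong[OF c(1), of d']
    by (intro conjI cong_add cong_sym[OF c(1)] cong_sym[OF c(2)] cong_refl)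
  have "d = d' \<and> e = e'" using step_eq_iff[OF assms(2,3) h(1,2), of i j] h(4) by (simp add: move)
  then show "y = vtx (i + d) (j - e * S d i)" using move[of "- e'"] by (simp add: h(5))
next
  assume "y = vtx (i + d) (j - e * S d i)"
  then show "same_side (vtx i j) (vtx (i + d) (j + e * S d i)) y"
    using assms unfolding same_side_def by blast
qed

text \<open>The walk around the cycle spanned by levels 0 and \<open>d\<close>, starting at
  \<open>vtx 0 0\<close> and adding the same displacement at each step.\<close>

definition zigzag :: "int \<Rightarrow> int \<Rightarrow> nat \<Rightarrow> 'a" where
  "zigzag d e t = vtx (d * (int t mod 2)) (int t * (e * S d 0))"

lemma same_side_zigzag:
  assumes d: "d \<in> {1, -1}" and e: "e \<in> {1, -1}"
  shows "same_side (zigzag d e (Suc t)) (zigzag d e t) y \<longleftrightarrow> y = zigzag d e (Suc (Suc t))"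
proof (cases "even t")
  case True
  then have m: "int t mod 2 = 0" "int (Suc t) mod 2 = 1" "int (Suc (Suc t)) mod 2 = 0" by presburger+
  have S: "S (- d) d = S d 0" using S_inverse[OF d, of 0] by simp
  have 1: "zigzag d e t = vtx (d + - d) (int (Suc t) * (e * S d 0) + (- e) * S (- d) d)"
    unfolding zigzag_def m S by (simp add: algebra_simps)
  have 2: "zigzag d e (Suc (Suc t)) = vtx (d + - d) (int (Suc t) * (e * S d 0) - (- e) * S (- d) d)"
    unfolding zigzag_def m S by (simp add: algebra_simps)
  have 3: "zigzag d e (Suc t) = vtx d (int (Suc t) * (e * S d 0))"
    unfolding zigzag_def m by simp
  have "even (d + int (Suc t) * (e * S d 0))" using d e True by auto
  moreover have "- d \<in> {1, -1}" "- e \<in> {1, -1}" using d e by auto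
  ultimately show ?thesis unfolding 1 2 3 by (rule same_side_iff)
next
  case False
  then have m: "int t mod 2 = 1" "int (Suc t) mod 2 = 0" "int (Suc (Suc t)) mod 2 = 1" by presburger+
  have 1: "zigzag d e t = vtx (0 + d) (int (Suc t) * (e * S d 0) + (- e) * S d 0)"
    unfolding zigzag_def m by (simp add: algebra_simps)
  have 2: "zigzag d e (Suc (Suc t)) = vtx (0 + d) (int (Suc t) * (e * S d 0) - (- e) * S d 0)"
    unfolding zigzag_def m by (simp add: algebra_simps)
  have 3: "zigzag d e (Suc t) = vtx 0 (int (Suc t) * (e * S d 0))"
    unfolding zigzag_def m by simp
  have "even (0 + int (Suc t) * (e * S d 0))" using False by auto
  moreover have "- e \<in> {1, -1}" using e by auto
  ultimately show ?thesis unfolding 1 2 3 using d by (intro same_side_iff)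
qed

text \<open>Along such a cycle the next vertex is the other neighbour on the same side, so a map
  that preserves sides is determined there by two consecutive vertices.\<close>

lemma zigzag_image:
  assumes sides: "\<And>v x y. same_side v x y \<Longrightarrow> same_side (g v) (g x) (g y)"
    and d: "d \<in> {1, -1}" "d' \<in> {1, -1}" and e: "e \<in> {1, -1}" "e' \<in> {1, -1}"
    and g: "g (vtx 0 0) = vtx 0 0" "g (vtx d (e * S d 0)) = vtx d' (e' * S d' 0)"
  shows "g (zigzag d e t) = zigzag d' e' t"
proof -
  have "g (zigzag d e t) = zigzag d' e' t \<and> g (zigzag d e (Suc t)) = zigzag d' e' (Suc t)"
  proof (induction t)
    case 0
    show ?case using g by (simp add: zigzag_def)
  next
    case (Suc t)
    have "same_side (zigzag d e (Suc t)) (zigzag d e t) (zigzag d e (Suc (Suc t)))"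
      by (simp only: same_side_zigzag[OF d(1) e(1)])
    from sides[OF this] Suc have "g (zigzag d e (Suc (Suc t))) = zigzag d' e' (Suc (Suc t))"
      by (simp add: same_side_zigzag[OF d(2) e(2)])
    with Suc show ?case by simp
  qed
  then show ?thesis by simp
qed

lemma arc_transitive_base:
  assumes "arc_transitive X" "d \<in> {1, -1}" "e \<in> {1, -1}"
  obtains g where "g \<in> automorphisms X" "g (vtx 0 0) = vtx 0 0" "g (vtx 1 1) = vtx d (e * S d 0)"
proof -
  have "(vtx 0 0, vtx 1 1) \<in> parcs X" "(vtx 0 0, vtx d (e * S d 0)) \<in> parcs X"
    using vtx_arc[of 0 0 1 1] vtx_arc[of 0 0 d e] assms(2,3) by simp_all
  then show ?thesis using assms(1) that unfolding arc_transitive_def by fastforce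
qed

lemma square_if_sides_preserved:
  assumes sides: "\<And>g v x y. g \<in> automorphisms X \<Longrightarrow> same_side v x y \<Longrightarrow> same_side (g v) (g x) (g y)"
    and "arc_transitive X"
  shows "\<exists>s\<in>{1, -1}. [r ^ 2 = s] (mod n1)"
proof -
  obtain g where g: "g \<in> automorphisms X" "g (vtx 0 0) = vtx 0 0" "g (vtx 1 1) = vtx (-1) (1 * S (-1) 0)"
    by (rule arc_transitive_base[OF assms(2), of "-1" 1]) auto
  have z1: "g (zigzag 1 1 t) = zigzag (-1) 1 t" for t
    by (rule zigzag_image) (use sides[OF g(1)] g(2,3) in simp_all)
  have "(vtx 0 0, g (vtx (-1) (r ^ 3))) \<in> parcs X"
    using automorphisms_arc_iff[OF g(1), of "vtx 0 0" "vtx (-1) (r ^ 3)"] vtx_arc[of 0 0 "-1" 1]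
      vtx_in_verts[of 0 0] vtx_in_verts[of "-1" "r ^ 3"] odd_r by (simp add: g(2))
  then obtain d e where de: "d \<in> {1, -1}" "e \<in> {1, -1}" "g (vtx (-1) (r ^ 3)) = vtx d (e * S d 0)"
    unfolding neighbours_base by blast
  \<comment> \<open>Otherwise \<open>g\<close> would send three neighbours of \<open>vtx 0 0\<close>
    to the two on level -1.\<close>
  have "d \<noteq> -1"
  proof
    assume d: "d = -1"
    have "same_side (vtx 0 0) (vtx 1 1) (vtx 1 (-1))"
      using same_side_iff[of 0 0 1 1] by simp
    from sides[OF g(1) this] have "g (vtx 1 (-1)) = vtx (-1) (- (r ^ 3))"
      using same_side_iff[of 0 0 "-1" 1] by (simp add: g(2,3))
    then have "g (vtx (-1) (r ^ 3)) \<in> {g (vtx 1 1), g (vtx 1 (-1))}"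
      using de d g(3) by auto
    then have "vtx (-1) (r ^ 3) = vtx 1 1 \<or> vtx (-1) (r ^ 3) = vtx 1 (-1)"
      by (simp add: automorphisms_eq_iff[OF g(1)])
    then show False by (auto simp: vtx_eq_iff cong_def)
  qed
  then have d: "d = 1" using de(1) by simp
  have z2: "g (zigzag (-1) 1 t) = zigzag 1 e t" for t
    by (rule zigzag_image) (use sides[OF g(1)] g(2) de d in simp_all)
  \<comment> \<open>Position \<open>t\<close> of the upward cycle and position 2 of the downward
    cycle are the same vertex \<open>vtx 0 (2 * r ^ 3)\<close>. Comparing its images along both
    cycles gives \<open>2 * r ^ 6 = 2 * e\<close> modulo \<open>n\<close>, where
    \<open>r ^ 6 = r ^ 2\<close>.\<close>
  define t where "t = nat (2 * (r ^ 3 mod n))"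
  have t: "int t = 2 * (r ^ 3 mod n)" "int t mod 2 = 0" using n1_pos by (simp_all add: t_def)
  have "vtx 0 (2 * (r ^ 3 mod n) * r ^ 3) = g (vtx 0 (2 * (r ^ 3 mod n)))"
    using z1[of t] by (simp add: zigzag_def t)
  also have "vtx 0 (2 * (r ^ 3 mod n)) = vtx 0 (2 * r ^ 3)"
    by (auto simp: vtx_eq_iff cong_def mod_mult_right_eq)
  also have "g \<dots> = vtx 0 (2 * e)" using z2[of 2] by (simp add: zigzag_def)
  finally have "[2 * (r ^ 3 mod n) * r ^ 3 = 2 * e] (mod n)" by (simp add: vtx_eq_iff)
  then have "[2 * e = 2 * (r ^ 3 mod n) * r ^ 3] (mod n)" by (rule cong_sym)
  also have "[2 * (r ^ 3 mod n) * r ^ 3 = 2 * r ^ 3 * r ^ 3] (mod n)"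
    by (intro cong_mult cong_refl) simp
  also have "2 * r ^ 3 * r ^ 3 = 2 * r ^ 2 * r ^ 4" by (simp add: numeral_eq_Suc mult_ac)
  also have "[2 * r ^ 2 * r ^ 4 = 2 * r ^ 2 * 1] (mod n)" by (intro cong_mult cong_refl r4)
  finally have "[2 * r ^ 2 = 2 * e] (mod n)" by (simp only: cong_sym_eq mult_1_right)
  then have "n dvd 2 * (r ^ 2 - e)" by (simp only: cong_iff_dvd_diff right_diff_distrib)
  then have "n1 dvd r ^ 2 - e" unfolding dvd_mult_cancel_left by simp
  then have "[r ^ 2 = e] (mod n1)" by (simp only: cong_iff_dvd_diff)
  then show ?thesis using de(2) by blast
qed

end

section \<open>The case of 4-cycles\<close>

text \<open>Here \<open>k > 2\<close> excludes \<open>r ^ 2 = -1\<close> modulo \<open>n1\<close>,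
  and \<open>l > 1\<close> excludes \<open>r ^ 2 = 1\<close>.\<close>

locale factored_component = metacirculant_component +
  fixes k l :: int
  assumes n1_eq: "n1 = k * l" and k_dvd: "k dvd r ^ 2 - 1" and l_dvd: "l dvd r ^ 2 + 1"
    and odd_l: "odd l" and l_gt: "l > 1" and k_gt: "k > 2"
begin

lemma even_k: "even k"
  using even_n1 odd_l by (simp add: n1_eq)

text \<open>As \<open>r\<close> is odd, \<open>r ^ 2 - 1\<close> is \<open>4 * v\<close> and half of
  \<open>r ^ 2 + 1\<close> is \<open>2 * v + 1\<close>. These are coprime; \<open>k\<close> divides
  the former and \<open>l\<close>, being odd, the latter.\<close>

lemma square_r: obtains v where "r ^ 2 = 4 * v + 1" "k dvd 4 * v" "l dvd 2 * v + 1"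
  "coprime k (2 * v + 1)" "coprime k l"
proof -
  obtain q where q: "r = 2 * q + 1" using odd_r by (rule oddE)
  define v where "v = q * (q + 1)"
  have r2: "r ^ 2 = 4 * v + 1" by (simp add: q v_def power2_eq_square algebra_simps)
  have k4: "k dvd 4 * v" using k_dvd by (simp add: r2)
  have "l dvd 2 * (2 * v + 1)" using l_dvd by (simp add: r2 algebra_simps)
  moreover have "coprime l 2" using odd_l by simp
  ultimately have l2: "l dvd 2 * v + 1" by (simp only: coprime_dvd_mult_right_iff)
  have "coprime v (2 * v + 1)"
    by (rule coprimeI) (metis dvd_add_right_iff dvd_mult)
  moreover have "coprime (4::int) (2 * v + 1)"
    using coprime_power_left_iff[of 2 2 "2 * v + 1"] by simp
  ultimately have cop: "coprime (4 * v) (2 * v + 1)" by simp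
  have "coprime k (2 * v + 1)" using coprime_divisors[OF k4 dvd_refl cop] .
  moreover have "coprime k l" using coprime_divisors[OF k4 l2 cop] .
  ultimately show ?thesis using that r2 k4 l2 by blast
qed

text \<open>
  Splitting the displacement of a walk along \<open>n1 = k l\<close>: modulo \<open>k\<close> one has \<open>r\<^sup>2 = 1\<close> and modulo
  \<open>l\<close> one has \<open>r\<^sup>2 = -1\<close>.  The parity hypothesis is what makes the factor \<open>2\<close> of \<open>n\<close> harmless.
\<close>

lemma displacement_dvd_iff:
  assumes "even (A + a + B + b)"
  shows "n dvd (A + a) + (B + b) * r + (A - a) * r ^ 2 + (B - b) * r ^ 3 \<longleftrightarrow>
    k dvd A + B * r \<and> l dvd a + b * r"
proof -
  obtain v where v: "r ^ 2 = 4 * v + 1" "k dvd 4 * v" "l dvd 2 * v + 1"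
    "coprime k (2 * v + 1)" "coprime k l" by (rule square_r)
  define x y where "x = A + B * r" and "y = a + b * r"
  \<comment> \<open>Half of the displacement. Modulo \<open>l\<close> it is \<open>y\<close>; modulo
    \<open>k\<close> it is a unit times \<open>x\<close>, minus \<open>2 * v * y\<close>, and this
    last term vanishes once \<open>y\<close> is even.\<close>
  define z where "z = (2 * v + 1) * x - 2 * v * y"
  have r3: "r ^ 3 = (4 * v + 1) * r" using v(1) by (simp add: power3_eq_cube power2_eq_square)
  have "(A + a) + (B + b) * r + (A - a) * r ^ 2 + (B - b) * r ^ 3 = 2 * z"
    unfolding v(1) r3 z_def x_def y_def by (simp add: algebra_simps)
  then have "n dvd (A + a) + (B + b) * r + (A - a) * r ^ 2 + (B - b) * r ^ 3 \<longleftrightarrow> k * l dvd z"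
    by (simp add: n1_eq mult.assoc)
  also have "\<dots> \<longleftrightarrow> k dvd z \<and> l dvd z"
    using divides_mult[OF _ _ v(5)] by (auto dest: dvd_mult_left dvd_mult_right)
  also have "k dvd z \<longleftrightarrow> k dvd x"
  proof -
    have xy: "even x \<longleftrightarrow> even y" using assms odd_r by (auto simp: x_def y_def)
    have "k dvd 2 * v * y" if y: "even y"
    proof -
      obtain y' where "y = 2 * y'" using y by (rule evenE)
      then have "2 * v * y = 4 * v * y'" by simp
      with v(2) show ?thesis by (metis dvd_mult2)
    qed
    moreover have "even y" if "k dvd z"
    proof -
      have "even z" using even_k that by (rule dvd_trans)
      then show ?thesis unfolding xy[symmetric] by (simp add: z_def)
    qed
    moreover have "even y" if "k dvd x" using even_k that dvd_trans xy by blast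
    ultimately show ?thesis
      unfolding z_def by (metis coprime_dvd_mult_right_iff dvd_diff_left_iff dvd_mult v(4))
  qed
  also have "l dvd z \<longleftrightarrow> l dvd y"
  proof -
    have "z = (2 * v + 1) * (x - y) + y" by (simp add: z_def algebra_simps)
    then show ?thesis using v(3) by (simp add: dvd_add_right_iff)
  qed
  finally show ?thesis by (simp add: x_def y_def)
qed

lemma l_dvd_double: "l dvd 2 * x \<longleftrightarrow> l dvd x"
  using odd_l by (simp add: coprime_dvd_mult_right_iff)

text \<open>Modulo \<open>l\<close> the number \<open>r\<close> is a square root of -1, and the sum
  of squares is the norm of \<open>a + b * r\<close>.\<close>

lemma l_dvd_norm:
  assumes "l dvd a + b * r"
  shows "l dvd a\<^sup>2 + b\<^sup>2"
proof -
  have "a\<^sup>2 + b\<^sup>2 = (a + b * r) * (a - b * r) + b\<^sup>2 * (r\<^sup>2 + 1)"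
    by (simp add: power2_eq_square algebra_simps)
  then show ?thesis using assms l_dvd by simp
qed

text \<open>The norm is 0, 1 or 2, and of these an odd \<open>l > 1\<close> divides only 0.\<close>

lemma l_dvd_small:
  assumes "l dvd a + b * r" "a \<in> {-1, 0, 1}" "b \<in> {-1, 0, 1}"
  shows "a = 0" "b = 0"
proof -
  have "\<not> l dvd 1" "\<not> l dvd 2"
    using l_gt odd_l by (auto dest!: zdvd_imp_le simp: le_less)
  then show "a = 0" "b = 0" using l_dvd_norm[OF assms(1)] assms(2,3) by auto
qed

text \<open>Opposite vertices of a 4-cycle \<open>u\<close>, \<open>a\<close>, \<open>w\<close>,
  \<open>b\<close>.\<close>

definition antipodal :: "'a \<Rightarrow> 'a \<Rightarrow> bool" where
  "antipodal u w \<longleftrightarrow> u \<noteq> w \<and> (\<exists>a b. a \<noteq> b \<and> (u, a) \<in> parcs X \<and> (a, w) \<in> parcs X \<and>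
    (u, b) \<in> parcs X \<and> (b, w) \<in> parcs X)"

lemma antipodal_automorphism:
  assumes g: "g \<in> automorphisms X" and "antipodal u w"
  shows "antipodal (g u) (g w)"
proof -
  obtain a b where h: "u \<noteq> w" "a \<noteq> b" "(u, a) \<in> parcs X" "(a, w) \<in> parcs X"
    "(u, b) \<in> parcs X" "(b, w) \<in> parcs X" using assms(2) unfolding antipodal_def by blast
  have "(g x, g y) \<in> parcs X" if "(x, y) \<in> parcs X" for x y
    using automorphisms_arc_iff[OF g, of x y] that arcs_subset by blast
  then show ?thesis unfolding antipodal_def using h automorphisms_eq_iff[OF g] by metis
qed

lemma S_simps' [simp]: "S (-1) (-1) = r ^ 2" "S 1 (-2) = r ^ 2" "S (-1) (-2) = r"
  by (simp_all add: step_coeff_def)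

lemma displacement_dvdD:
  assumes "n dvd c0 + c1 * r + c2 * r ^ 2 + c3 * r ^ 3"
    and "c0 = A + a" "c1 = B + b" "c2 = A - a" "c3 = B - b" "even (A + a + B + b)"
  shows "k dvd A + B * r" "l dvd a + b * r"
  using displacement_dvd_iff[OF assms(6)] assms(1-5) by simp_all

end

locale four_cycle_component = factored_component +
  fixes s :: int
  assumes s: "s \<in> {1, -1}" and k_dvd_r: "k dvd 1 + s * r"
begin

lemma k_not_dvd_2: "\<not> k dvd 2"
  using k_gt by (auto dest: zdvd_imp_le)

text \<open>The closed walk through all four levels with signs \<open>1\<close>, \<open>s\<close>,
  \<open>1\<close>, \<open>s\<close>, for which \<open>A = 1\<close>, \<open>B = s\<close> and
  \<open>a = b = 0\<close>.\<close>

lemma cycle_dvd: "n dvd 1 + s * r + r ^ 2 + s * r ^ 3"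
proof -
  have "even (1 + 0 + s + 0)" using s by auto
  from displacement_dvd_iff[OF this] show ?thesis using k_dvd_r by simp
qed

lemma uminus_sign: "e \<in> {1, -1 :: int} \<Longrightarrow> - e \<in> {1, -1}"
  by auto

lemma sign_halves:
  assumes "x \<in> {1, -1 :: int}" "y \<in> {1, -1}"
  shows "\<exists>a b. x = a + b \<and> y = a - b \<and> a \<in> {-1, 0, 1} \<and> b \<in> {-1, 0, 1}"
proof (cases "x = y")
  case True
  then show ?thesis using assms by (intro exI[of _ x] exI[of _ 0]) auto
next
  case False
  then show ?thesis using assms by (intro exI[of _ 0] exI[of _ x]) auto
qed

text \<open>The two paths form a 4-cycle. Unless one goes up twice and the other down twice, the
  condition modulo \<open>l\<close> has coefficients in -1, 0, 1 that are not both 0, against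
  \<open>l_dvd_small\<close>.\<close>

lemma two_steps:
  assumes h: "d1 \<in> {1, -1}" "e1 \<in> {1, -1}" "d2 \<in> {1, -1}" "e2 \<in> {1, -1}"
    "d1' \<in> {1, -1}" "e1' \<in> {1, -1}" "d2' \<in> {1, -1}" "e2' \<in> {1, -1}"
    and w: "w = vtx (d1 + d1') (e1 * S d1 0 + e1' * S d1' d1)"
    "w = vtx (d2 + d2') (e2 * S d2 0 + e2' * S d2' d2)"
    and ne: "w \<noteq> vtx 0 0" "d1 \<noteq> d2 \<or> e1 \<noteq> e2"
  shows "\<exists>e\<in>{1, -1}. w = vtx 2 (e * (1 + s * r))"
proof -
  have level: "[d1 + d1' = d2 + d2'] (mod 4)"
    and disp: "n dvd e1 * S d1 0 + e1' * S d1' d1 - (e2 * S d2 0 + e2' * S d2' d2)"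
    using w(2) unfolding w(1) by (simp_all add: vtx_eq_iff cong_iff_dvd_diff)
  \<comment> \<open>A path that comes back to level 0 with the opposite sign retraces its first step
    and ends at \<open>vtx 0 0\<close>.\<close>
  have back1: "e1' = e1" if "d1' = - d1"
  proof (rule ccontr)
    assume "e1' \<noteq> e1"
    then have "e1' = - e1" using h by auto
    then have "w = vtx 0 0" using w(1) that S_inverse[OF h(1), of 0] by simp
    then show False using ne by simp
  qed
  have back2: "e2' = e2" if "d2' = - d2"
  proof (rule ccontr)
    assume "e2' \<noteq> e2"
    then have "e2' = - e2" using h by auto
    then have "w = vtx 0 0" using w(2) that S_inverse[OF h(3), of 0] by simp
    then show False using ne by simp
  qed
  have cases: "(d1 = 1 \<and> d2 = 1 \<and> d1' = 1 \<and> d2' = 1) \<or> (d1 = 1 \<and> d2 = 1 \<and> d1' = -1 \<and> d2' = -1) \<or>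
    (d1 = -1 \<and> d2 = -1 \<and> d1' = 1 \<and> d2' = 1) \<or> (d1 = -1 \<and> d2 = -1 \<and> d1' = -1 \<and> d2' = -1) \<or>
    (d1 = 1 \<and> d2 = -1 \<and> d1' = -1 \<and> d2' = 1) \<or> (d1 = -1 \<and> d2 = 1 \<and> d1' = 1 \<and> d2' = -1) \<or>
    (d1 = 1 \<and> d2 = -1 \<and> d1' = 1 \<and> d2' = -1) \<or> (d1 = -1 \<and> d2 = 1 \<and> d1' = -1 \<and> d2' = 1)"
    using h(1,3,5,7) level by (elim insertE emptyE; simp add: cong_def)
  \<comment> \<open>One path goes up twice, the other down twice. Modulo \<open>l\<close> the
    coefficients \<open>a\<close> and \<open>b\<close> must vanish; modulo \<open>k\<close> the
    upward signs must satisfy \<open>f1' = s * f1\<close>, since otherwise \<open>k\<close> would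
    divide 2.\<close>
  have directed: "\<exists>e\<in>{1, -1}. w = vtx 2 (e * (1 + s * r))"
    if w': "w = vtx 2 (f1 + f1' * r)" and f: "f1 \<in> {1, -1}" "f1' \<in> {1, -1}" "f2 \<in> {1, -1}" "f2' \<in> {1, -1}"
      and dvd: "n dvd f1 + f1' * r - (f2 * r ^ 3 + f2' * r ^ 2)" for f1 f1' f2 f2'
  proof -
    obtain A a where A: "f1 = A + a" "- f2' = A - a" "a \<in> {-1, 0, 1}"
      using sign_halves[OF f(1) uminus_sign[OF f(4)]] by blast
    obtain B b where B: "f1' = B + b" "- f2 = B - b" "b \<in> {-1, 0, 1}"
      using sign_halves[OF f(2) uminus_sign[OF f(3)]] by blast
    have dvd': "n dvd f1 + f1' * r + - f2' * r ^ 2 + - f2 * r ^ 3"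
      using dvd by (simp add: algebra_simps)
    have "odd f1" "odd f1'" using f by auto
    then have ev: "even (A + a + B + b)" using A(1) B(1) by simp
    note * = displacement_dvdD[OF dvd' A(1) B(1) A(2) B(2) ev]
    have "a = 0" "b = 0" using l_dvd_small[OF *(2) A(3) B(3)] by auto
    then have "k dvd f1 + f1' * r" using *(1) A(1) B(1) by simp
    have "f1' = s * f1"
    proof (rule ccontr)
      assume "f1' \<noteq> s * f1"
      then have "f1' = - s * f1" using f s by auto
      then have "k dvd f1 * (1 - s * r)" using \<open>k dvd f1 + f1' * r\<close> by (simp add: algebra_simps)
      then have "k dvd f1 * (f1 * (1 - s * r))" by (rule dvd_mult)
      moreover have "f1 * (f1 * (1 - s * r)) = 1 - s * r" using f(1) by auto
      ultimately have "k dvd 1 - s * r" by simp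
      then have "k dvd (1 - s * r) + (1 + s * r)" using k_dvd_r by (rule dvd_add)
      then show False using k_not_dvd_2 by simp
    qed
    then have "w = vtx 2 (f1 * (1 + s * r))" by (simp add: w' algebra_simps)
    then show ?thesis using f(1) by blast
  qed
  obtain a where a: "e1 - e2 = 2 * a" "a \<in> {-1, 0, 1}"
    using sign_halves[OF h(2) uminus_sign[OF h(4)]] by fastforce
  obtain b where b: "e1' - e2' = 2 * b" "b \<in> {-1, 0, 1}"
    using sign_halves[OF h(6) uminus_sign[OF h(8)]] by fastforce
  have fork: False if "a = 0" "d1 = d2" using that a ne(2) by simp
  show ?thesis using cases
  proof (elim disjE conjE)
    assume c: "d1 = 1" "d2 = 1" "d1' = 1" "d2' = 1"
    have "e1 + e1' * r - (e2 + e2' * r) = (e1 - e2) + (e1' - e2') * r"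
      by (simp add: algebra_simps)
    then have "n dvd 2 * a + 2 * b * r + 0 * r ^ 2 + 0 * r ^ 3"
      using disp by (simp add: c a b)
    then have "l dvd a + b * r" by (rule displacement_dvdD(2)[where A = a and B = b]) simp_all
    from l_dvd_small(1)[OF this a(2) b(2)] show ?thesis using fork c by simp
  next
    assume c: "d1 = 1" "d2 = 1" "d1' = -1" "d2' = -1"
    have "e1 + e1 - (e2 + e2) = 2 * (e1 - e2)" by simp
    then have "n dvd 4 * a + 0 * r + 0 * r ^ 2 + 0 * r ^ 3"
      using disp back1 back2 by (simp add: c a)
    then have "l dvd 2 * a + 0 * r"
      by (rule displacement_dvdD(2)[where A = "2 * a" and B = 0]) simp_all
    then have "l dvd 2 * (a + 0 * r)" by simp
    then have "l dvd a + 0 * r"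
      by (simp only: l_dvd_double)
    from l_dvd_small(1)[OF this a(2)] show ?thesis using fork c by simp
  next
    assume c: "d1 = -1" "d2 = -1" "d1' = 1" "d2' = 1"
    have "e1 * r ^ 3 + e1 * r ^ 3 - (e2 * r ^ 3 + e2 * r ^ 3) = 2 * (e1 - e2) * r ^ 3"
      by (simp add: algebra_simps)
    then have "n dvd 0 + 0 * r + 0 * r ^ 2 + 4 * a * r ^ 3"
      using disp back1 back2 by (simp add: c a)
    then have "l dvd 0 + (- 2 * a) * r"
      by (rule displacement_dvdD(2)[where A = 0 and B = "2 * a"]) simp_all
    then have "l dvd 2 * (0 + (- a) * r)" by (simp add: mult.assoc)
    then have "l dvd 0 + (- a) * r"
      by (simp only: l_dvd_double)
    from l_dvd_small(2)[OF this] show ?thesis using fork c a(2) by auto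
  next
    assume c: "d1 = -1" "d2 = -1" "d1' = -1" "d2' = -1"
    have "e1 * r ^ 3 + e1' * r ^ 2 - (e2 * r ^ 3 + e2' * r ^ 2) = (e1' - e2') * r ^ 2 + (e1 - e2) * r ^ 3"
      by (simp add: algebra_simps)
    then have "n dvd 0 + 0 * r + 2 * b * r ^ 2 + 2 * a * r ^ 3"
      using disp by (simp add: c a b)
    then have "l dvd (- b) + (- a) * r"
      by (rule displacement_dvdD(2)[where A = b and B = a]) simp_all
    from l_dvd_small(2)[OF this] show ?thesis using fork c a(2) b(2) by auto
  next
    assume c: "d1 = 1" "d2 = -1" "d1' = -1" "d2' = 1"
    have "n dvd 2 * e1 + 0 * r + 0 * r ^ 2 + (- 2 * e2) * r ^ 3"
      using disp back1 back2 by (simp add: c algebra_simps)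
    then have "l dvd e1 + e2 * r"
      by (rule displacement_dvdD(2)[where A = e1 and B = "- e2"]) (use h in auto)
    from l_dvd_small(1)[OF this] show ?thesis using h by auto
  next
    assume c: "d1 = -1" "d2 = 1" "d1' = 1" "d2' = -1"
    have "n dvd (- 2 * e2) + 0 * r + 0 * r ^ 2 + 2 * e1 * r ^ 3"
      using disp back1 back2 by (simp add: c algebra_simps)
    then have "l dvd - e2 + - e1 * r"
      by (rule displacement_dvdD(2)[where A = "- e2" and B = e1]) (use h in auto)
    from l_dvd_small(1)[OF this] show ?thesis using h by auto
  next
    assume c: "d1 = 1" "d2 = -1" "d1' = 1" "d2' = -1"
    show ?thesis
      by (rule directed[of e1 e1' e2 e2']) (use h w(1) disp in \<open>simp_all add: c\<close>)
  next
    assume c: "d1 = -1" "d2 = 1" "d1' = -1" "d2' = 1"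
    have "n dvd e2 + e2' * r - (e1 * r ^ 3 + e1' * r ^ 2)"
      using disp dvd_minus_iff[of n "e1 * r ^ 3 + e1' * r ^ 2 - (e2 + e2' * r)"] by (simp add: c)
    then show ?thesis
      by (intro directed[of e2 e2' e1 e1']) (use h w(2) in \<open>simp_all add: c\<close>)
  qed
qed

end

section \<open>Chains of opposite vertices of 4-cycles\<close>

context four_cycle_component
begin

text \<open>\<open>two_steps\<close> leaves no other antipodes. Conversely, the upward path with
  signs \<open>e\<close>, \<open>e * s\<close> and the downward path with signs
  \<open>- e * s\<close>, \<open>- e\<close> end at the same vertex by
  \<open>cycle_dvd\<close>.\<close>

lemma antipodal_base: "antipodal (vtx 0 0) w \<longleftrightarrow> (\<exists>e\<in>{1, -1}. w = vtx 2 (e * (1 + s * r)))"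
proof
  assume "antipodal (vtx 0 0) w"
  then obtain a b where h: "vtx 0 0 \<noteq> w" "a \<noteq> b" "(vtx 0 0, a) \<in> parcs X" "(a, w) \<in> parcs X"
    "(vtx 0 0, b) \<in> parcs X" "(b, w) \<in> parcs X" unfolding antipodal_def by blast
  obtain d1 e1 where 1: "d1 \<in> {1, -1}" "e1 \<in> {1, -1}" "a = vtx d1 (e1 * S d1 0)"
    using h(3) unfolding neighbours_base by blast
  obtain d2 e2 where 2: "d2 \<in> {1, -1}" "e2 \<in> {1, -1}" "b = vtx d2 (e2 * S d2 0)"
    using h(5) unfolding neighbours_base by blast
  have ev: "even (d1 + e1 * S d1 0)" "even (d2 + e2 * S d2 0)" using 1 2 by auto
  obtain d1' e1' where 3: "d1' \<in> {1, -1}" "e1' \<in> {1, -1}"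
    "w = vtx (d1 + d1') (e1 * S d1 0 + e1' * S d1' d1)"
    using h(4) unfolding 1(3) neighbours[OF ev(1)] by blast
  obtain d2' e2' where 4: "d2' \<in> {1, -1}" "e2' \<in> {1, -1}"
    "w = vtx (d2 + d2') (e2 * S d2 0 + e2' * S d2' d2)"
    using h(6) unfolding 2(3) neighbours[OF ev(2)] by blast
  show "\<exists>e\<in>{1, -1}. w = vtx 2 (e * (1 + s * r))"
    by (rule two_steps[OF 1(1,2) 2(1,2) 3(1,2) 4(1,2) 3(3) 4(3)]) (use h 1 2 in auto)
next
  assume "\<exists>e\<in>{1, -1}. w = vtx 2 (e * (1 + s * r))"
  then obtain e where e: "e \<in> {1, -1}" and w: "w = vtx 2 (e * (1 + s * r))" by blast
  have "(vtx 0 0, vtx 1 e) \<in> parcs X" by (rule arcI[where d = 1 and e = e]) (use e in auto)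
  moreover have "(vtx 1 e, w) \<in> parcs X" unfolding w
    by (rule arcI[where d = 1 and e = "e * s"]) (use e s in \<open>auto simp: algebra_simps\<close>)
  moreover have "(vtx 0 0, vtx (-1) (- e * s * r ^ 3)) \<in> parcs X"
    by (rule arcI[where d = "-1" and e = "- e * s"]) (use e s in auto)
  moreover have "(vtx (-1) (- e * s * r ^ 3), w) \<in> parcs X" unfolding w
  proof (rule arcI[where d = "-1" and e = "- e"])
    show "even (- 1 + - e * s * r ^ 3)" using e s odd_r by auto
    have "n dvd e * (1 + s * r + r ^ 2 + s * r ^ 3)" using cycle_dvd by simp
    then show "[e * (1 + s * r) = - e * s * r ^ 3 + - e * S (- 1) (- 1)] (mod n)"
      by (simp add: cong_iff_dvd_diff algebra_simps)
  qed (use e in \<open>auto simp: cong_def\<close>)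
  moreover have "vtx 1 e \<noteq> vtx (-1) (- e * s * r ^ 3)" "vtx 0 0 \<noteq> w"
    unfolding w by (auto simp: vtx_eq_iff cong_def)
  ultimately show "antipodal (vtx 0 0) w" unfolding antipodal_def by blast
qed

lemma antipodal_iff:
  assumes ij: "even (i + j)"
  shows "antipodal (vtx i j) w \<longleftrightarrow>
    (\<exists>e\<in>{1, -1}. w = vtx (i + 2) (j + e * r ^ nat (i mod 4) * (1 + s * r)))"
proof -
  obtain f where f: "f \<in> automorphisms X"
    "\<And>i' j'. even (i' + j') \<Longrightarrow> f (vtx i' j') = vtx (i' + i) (1 * r ^ nat (i mod 4) * j' + j)"
    by (rule rotation[OF ij, of 1]) auto
  have f0: "f (vtx 0 0) = vtx i j" using f(2)[of 0 0] by simp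
  have f2: "f (vtx 2 (e * (1 + s * r))) = vtx (i + 2) (j + e * r ^ nat (i mod 4) * (1 + s * r))"
    if "e \<in> {1, -1}" for e
    using f(2)[of 2 "e * (1 + s * r)"] s odd_r that by (auto simp: algebra_simps)
  show ?thesis
  proof
    assume "antipodal (vtx i j) w"
    from antipodal_automorphism[OF automorphisms_inv[OF f(1)] this]
    have "antipodal (vtx 0 0) (inv_into UNIV f w)"
      using automorphisms_inv_eq[OF f(1), of "vtx 0 0"] by (simp add: f0)
    then obtain e where e: "e \<in> {1, -1}" "inv_into UNIV f w = vtx 2 (e * (1 + s * r))"
      unfolding antipodal_base by blast
    have "w = f (inv_into UNIV f w)"
      using automorphisms_permutes[OF f(1)] by (simp add: permutes_inverses(1))
    then show "\<exists>e\<in>{1, -1}. w = vtx (i + 2) (j + e * r ^ nat (i mod 4) * (1 + s * r))"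
      using e f2 by metis
  next
    assume "\<exists>e\<in>{1, -1}. w = vtx (i + 2) (j + e * r ^ nat (i mod 4) * (1 + s * r))"
    then obtain e where e: "e \<in> {1, -1}" "w = f (vtx 2 (e * (1 + s * r)))" using f2 by metis
    then have "antipodal (vtx 0 0) (vtx 2 (e * (1 + s * r)))" unfolding antipodal_base by blast
    from antipodal_automorphism[OF f(1) this] show "antipodal (vtx i j) w"
      by (simp only: f0 e(2))
  qed
qed

lemma fixes_other_antipode:
  assumes "g \<in> automorphisms X" "g u = u" "g x = x" "antipodal u y" "\<And>w. antipodal u w \<Longrightarrow> w = x \<or> w = y"
  shows "g y = y"
  using antipodal_automorphism[OF assms(1,4)] assms(2,3,5) automorphisms_eq_iff[OF assms(1)] by metis

text \<open>The antipodes of a chain vertex are its predecessor and its successor, so two fixed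
  consecutive vertices force the next one to be fixed.\<close>

lemma fixes_antipodal_chain:
  assumes g: "g \<in> automorphisms X" "g (vtx 0 0) = vtx 0 0" "g (vtx 2 (1 + s * r)) = vtx 2 (1 + s * r)"
  defines "c \<equiv> 1 + s * r"
  shows "g (vtx 0 (2 * int t * c)) = vtx 0 (2 * int t * c) \<and>
    g (vtx 2 ((2 * int t + 1) * c)) = vtx 2 ((2 * int t + 1) * c)"
proof (induction t)
  case 0
  show ?case using g by (simp add: c_def)
next
  case (Suc t)
  have ev: "even c" using odd_r s by (auto simp: c_def)
  \<comment> \<open>As \<open>r ^ 2 * c = - c\<close> modulo \<open>n\<close>, the second
    coordinates of the antipodes of a chain vertex on level 2 again differ from its own by
    \<open>c\<close> and \<open>- c\<close>.\<close>
  have rc: "n dvd r ^ 2 * c + c"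
    using cycle_dvd by (simp add: c_def algebra_simps power2_eq_square power3_eq_cube)
  have eq4: "vtx (2 + 2) (j + e * r ^ nat (2 mod 4) * c) = vtx 0 (j - e * c)" if "e \<in> {1, -1}" for j e
  proof -
    have "n dvd e * (r ^ 2 * c + c)" using rc by simp
    then show ?thesis by (simp add: vtx_eq_iff cong_iff_dvd_diff algebra_simps)
  qed
  let ?x0 = "vtx 0 (2 * int t * c)" and ?x1 = "vtx 2 ((2 * int t + 1) * c)"
  let ?x2 = "vtx 0 (2 * int (Suc t) * c)" and ?x3 = "vtx 2 ((2 * int (Suc t) + 1) * c)"
  have a1: "antipodal ?x1 w \<longleftrightarrow> w = ?x0 \<or> w = ?x2" for w
  proof -
    have "antipodal ?x1 w \<longleftrightarrow> (\<exists>e\<in>{1, -1}. w = vtx 0 ((2 * int t + 1) * c - e * c))"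
    proof -
      have ev2: "even (2 + (2 * int t + 1) * c)" using ev by simp
      have "(\<exists>e\<in>{1, -1}. w = vtx (2 + 2) ((2 * int t + 1) * c + e * r ^ nat (2 mod 4) * c)) \<longleftrightarrow>
          (\<exists>e\<in>{1, -1}. w = vtx 0 ((2 * int t + 1) * c - e * c))"
        by (intro bex_cong refl) (simp only: eq4)
      then show ?thesis unfolding antipodal_iff[OF ev2, folded c_def] .
    qed
    then show ?thesis by (auto simp: algebra_simps)
  qed
  have a2: "antipodal ?x2 w \<longleftrightarrow> w = ?x3 \<or> w = ?x1" for w
  proof -
    have ev2: "even (0 + 2 * int (Suc t) * c)" using ev by simp
    show ?thesis unfolding antipodal_iff[OF ev2, folded c_def] by (auto simp: algebra_simps)
  qed
  have x2: "g ?x2 = ?x2"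
  proof (rule fixes_other_antipode[OF g(1)])
    show "g ?x1 = ?x1" "g ?x0 = ?x0" using Suc by blast+
    show "antipodal ?x1 ?x2" by (simp only: a1 simp_thms)
    show "w = ?x0 \<or> w = ?x2" if "antipodal ?x1 w" for w using that by (simp only: a1)
  qed
  have "g ?x3 = ?x3"
  proof (rule fixes_other_antipode[OF g(1) x2])
    show "g ?x1 = ?x1" using Suc by blast
    show "antipodal ?x2 ?x3" by (simp only: a2 simp_thms)
    show "w = ?x1 \<or> w = ?x3" if "antipodal ?x2 w" for w using that by (auto simp only: a2)
  qed
  with x2 show ?case by blast
qed

lemma sign_diff:
  assumes "e \<in> {1, -1 :: int}" "f \<in> {1, -1}"
  shows "\<exists>a\<in>{-1, 0, 1}. e - f = 2 * a"
  using assms by auto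

text \<open>The image of \<open>vtx 1 1\<close> is a common neighbour of two fixed vertices. The
  only other such neighbour is \<open>vtx (-1) (- s * r ^ 3)\<close>; it is excluded by following an
  antipode of \<open>vtx 1 1\<close> to a further vertex of the fixed chain.\<close>

lemma fixes_up_arc:
  assumes g: "g \<in> automorphisms X" "g (vtx 0 0) = vtx 0 0" "g (vtx 2 (1 + s * r)) = vtx 2 (1 + s * r)"
  shows "g (vtx 1 1) = vtx 1 1"
proof -
  define c where "c = 1 + s * r"
  have ss: "s * s = 1" using s by auto
  have ev: "even c" using odd_r s by (auto simp: c_def)
  have pres: "(g u, g v) \<in> parcs X" if "(u, v) \<in> parcs X" for u v
    using automorphisms_arc_iff[OF g(1), of u v] that arcs_subset by blast
  have "(vtx 0 0, vtx 1 1) \<in> parcs X" using vtx_arc[of 0 0 1 1] by simp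
  from pres[OF this] obtain d e where de: "d \<in> {1, -1}" "e \<in> {1, -1}" "g (vtx 1 1) = vtx d (e * S d 0)"
    unfolding g(2) neighbours_base by blast
  have "(vtx 1 1, vtx 2 c) \<in> parcs X"
    by (rule arcI[where d = 1 and e = s]) (use s in \<open>auto simp: c_def\<close>)
  from pres[OF this] have "(vtx d (e * S d 0), vtx 2 c) \<in> parcs X" by (simp add: de(3) g(3) c_def)
  moreover have "even (d + e * S d 0)" using de by auto
  ultimately obtain d' e' where de': "d' \<in> {1, -1}" "e' \<in> {1, -1}"
    "vtx 2 c = vtx (d + d') (e * S d 0 + e' * S d' d)" using neighbours by blast
  have level: "[2 = d + d'] (mod 4)" and disp: "[c = e * S d 0 + e' * S d' d] (mod n)"
    using de'(3) by (simp_all only: vtx_eq_iff)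
  have "d' = d" using level de(1) de'(1) by (elim insertE emptyE; simp add: cong_def)
  show ?thesis
  proof (cases "d = 1")
    case True
    have p1: "1 \<in> {1, - 1 :: int}" by simp
    obtain a where a: "e - 1 = 2 * a" "a \<in> {-1, 0, 1}" using sign_diff[OF de(2) p1] by blast
    obtain b where b: "e' - s = 2 * b" "b \<in> {-1, 0, 1}" using sign_diff[OF de'(2) s] by blast
    have "n dvd e + e' * r - (1 + s * r)"
      using disp True \<open>d' = d\<close> by (simp add: c_def cong_iff_dvd_diff dvd_diff_commute)
    moreover have "e + e' * r - (1 + s * r) = (e - 1) + (e' - s) * r" by (simp add: algebra_simps)
    ultimately have "n dvd 2 * a + 2 * b * r + 0 * r ^ 2 + 0 * r ^ 3" by (simp add: a(1) b(1))
    then have "l dvd a + b * r" by (rule displacement_dvdD(2)[where A = a and B = b]) simp_all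
    from l_dvd_small(1)[OF this a(2) b(2)] have "e = 1" using a by simp
    then show ?thesis using de(3) True by simp
  next
    case False
    then have d: "d = -1" "d' = -1" using de(1) \<open>d' = d\<close> by auto
    have m1: "- 1 \<in> {1, - 1 :: int}" by simp
    obtain A a where A: "-1 = A + a" "e' = A - a" "a \<in> {-1, 0, 1}"
      using sign_halves[OF m1 de'(2)] by blast
    obtain B b where B: "- s = B + b" "e = B - b" "b \<in> {-1, 0, 1}"
      using sign_halves[OF uminus_sign[OF s] de(2)] by blast
    have "n dvd e * r ^ 3 + e' * r ^ 2 - (1 + s * r)"
      using disp d by (simp add: c_def cong_iff_dvd_diff dvd_diff_commute)
    then have "n dvd - 1 + - s * r + e' * r ^ 2 + e * r ^ 3" by (simp add: algebra_simps)
    then have "l dvd a + b * r"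
    proof (rule displacement_dvdD(2)[OF _ A(1) B(1) A(2) B(2)])
      have "A + a + B + b = - 1 - s" using A(1) B(1) by simp
      then show "even (A + a + B + b)" using s by auto
    qed
    from l_dvd_small[OF this A(3) B(3)] have "e = - s" using B by simp
    then have x: "g (vtx 1 1) = vtx (-1) (- s * r ^ 3)" using de(3) d by simp
    \<comment> \<open>\<open>p\<close> is an antipode of \<open>vtx 1 1\<close> adjacent to the
      chain vertex \<open>z\<close>. As \<open>z\<close> is fixed, some antipode of
      \<open>vtx (-1) (- s * r ^ 3)\<close> would have to be adjacent to \<open>z\<close> as
      well.\<close>
    define p where "p = vtx 3 (1 - s * r * c)"
    define z where "z = vtx 0 (- 2 * s * r * c)"
    have "antipodal (vtx 1 1) p"
      unfolding p_def antipodal_iff[of 1 1, simplified] using s by (auto simp: c_def algebra_simps)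
    from antipodal_automorphism[OF g(1) this] have "antipodal (vtx (-1) (- s * r ^ 3)) (g p)"
      by (simp only: x)
    moreover have "even (- 1 + - s * r ^ 3)" using s odd_r by auto
    ultimately obtain f where f: "f \<in> {1, -1}"
      "g p = vtx (-1 + 2) (- s * r ^ 3 + f * r ^ nat (-1 mod 4) * c)"
      unfolding c_def using antipodal_iff by blast
    have gp: "g p = vtx 1 (- s * r ^ 3 + f * r ^ 3 * c)" using f(2) by simp
    have gz: "g z = z"
    proof -
      \<comment> \<open>The chain index of \<open>z\<close> is \<open>- s * r\<close>, reduced
        modulo \<open>n\<close> to make it a natural number.\<close>
      define t where "t = nat ((- s * r) mod n)"
      have "[2 * int t * c = 2 * (- s * r) * c] (mod n)"
        using n1_pos by (intro cong_mult cong_refl) (simp add: t_def)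
      then have "z = vtx 0 (2 * int t * c)" by (simp add: z_def vtx_eq_iff cong_sym_eq mult.assoc)
      then show ?thesis using fixes_antipodal_chain[OF g, of t] by (simp add: c_def)
    qed
    have "(p, z) \<in> parcs X" unfolding p_def z_def
    proof (rule arcI[where d = 1 and e = s])
      show "even (3 + (1 - s * r * c))" using ev by simp
      have "n dvd 1 + (s * s * r ^ 2 + s * r) + s * r ^ 3" using cycle_dvd ss by (simp add: algebra_simps)
      then have "n dvd - (1 + s * r * c + s * r ^ 3)"
        unfolding dvd_minus_iff by (simp add: c_def power2_eq_square algebra_simps)
      moreover have "- (1 + s * r * c + s * r ^ 3) = - 2 * s * r * c - (1 - s * r * c + s * S 1 3)"
        by simp
      ultimately show "[- 2 * s * r * c = 1 - s * r * c + s * S 1 3] (mod n)"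
        by (simp only: cong_iff_dvd_diff)
    qed (use s in \<open>auto simp: cong_def\<close>)
    from pres[OF this] have "(vtx 1 (- s * r ^ 3 + f * r ^ 3 * c), z) \<in> parcs X" by (simp only: gp gz)
    moreover have "even (1 + (- s * r ^ 3 + f * r ^ 3 * c))" using s f(1) odd_r ev by auto
    ultimately obtain d2 e2 where de2: "d2 \<in> {1, -1}" "e2 \<in> {1, -1}"
      "z = vtx (1 + d2) (- s * r ^ 3 + f * r ^ 3 * c + e2 * S d2 1)" using neighbours by blast
    have "[0 = 1 + d2] (mod 4)" and disp2: "[- 2 * s * r * c = - s * r ^ 3 + f * r ^ 3 * c + e2 * S d2 1] (mod n)"
      using de2(3) unfolding z_def by (simp_all only: vtx_eq_iff)
    then have "d2 = -1" using de2(1) by (auto simp: cong_def)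
    then have "n dvd (- s * r ^ 3 + f * r ^ 3 * c + e2) - (- 2 * s * r * c)"
      using cong_sym[OF disp2] by (simp add: cong_iff_dvd_diff)
    \<comment> \<open>Subtracting this multiple of \<open>n\<close> removes the term in
      \<open>r ^ 4\<close>.\<close>
    moreover have "n dvd f * s * (r ^ 4 - 1)" using r4 by (simp add: cong_iff_dvd_diff)
    ultimately have "n dvd (- s * r ^ 3 + f * r ^ 3 * c + e2) - (- 2 * s * r * c) - f * s * (r ^ 4 - 1)"
      by (rule dvd_diff)
    moreover have "(- s * r ^ 3 + f * r ^ 3 * c + e2) - (- 2 * s * r * c) - f * s * (r ^ 4 - 1) =
        (e2 + f * s) + 2 * s * r + 2 * (s * s) * r ^ 2 + (f - s) * r ^ 3"
      by (simp add: c_def numeral_eq_Suc algebra_simps)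
    ultimately have "n dvd (e2 + f * s) + 2 * s * r + 2 * (s * s) * r ^ 2 + (f - s) * r ^ 3"
      by (simp only:)
    then have dvd: "n dvd (e2 + f * s) + 2 * s * r + 2 * r ^ 2 + (f - s) * r ^ 3"
      by (simp only: ss mult_1_right)
    \<comment> \<open>If \<open>f = s\<close> or \<open>e2 = -1\<close>, the condition modulo
      \<open>l\<close> contradicts \<open>l_dvd_small\<close>; if \<open>f = - s\<close> and
      \<open>e2 = 1\<close>, the one modulo \<open>k\<close> gives \<open>k dvd 1\<close>.\<close>
    have False
    proof (cases "f = s")
      case True
      obtain a where a: "e2 + 1 = 2 * a" "a \<in> {0, 1}" using de2(2) by (cases "e2 = 1") auto
      have "n dvd 2 * a + 2 * s * r + 2 * r ^ 2 + 0 * r ^ 3" using dvd by (simp add: True ss a)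
      then have "l dvd (a - 1) + s * r"
        by (rule displacement_dvdD(2)[where A = "a + 1" and B = s]) (use s in auto)
      from l_dvd_small(2)[OF this] show False using a(2) s by auto
    next
      case False
      then have fs: "f = - s" using f(1) s by auto
      show False
      proof (cases "e2 = 1")
        case True
        have "n dvd 0 + 2 * s * r + 2 * r ^ 2 + (- 2 * s) * r ^ 3" using dvd by (simp add: fs ss True)
        then have "k dvd 1 + 0 * r"
          by (rule displacement_dvdD(1)[where a = "-1" and b = "2 * s"]) simp_all
        then show False using k_gt by auto
      next
        case False
        then have e2: "e2 = -1" using de2(2) by auto
        have "n dvd (- 2) + 2 * s * r + 2 * r ^ 2 + (- 2 * s) * r ^ 3" using dvd by (simp add: fs ss e2)
        then have "l dvd (- 2) + 2 * s * r"
          by (rule displacement_dvdD(2)[where A = 0 and B = 0]) simp_all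
        then have "l dvd 2 * (- 1 + s * r)" by (simp add: algebra_simps)
        then have "l dvd - 1 + s * r" by (simp only: l_dvd_double)
        from l_dvd_small(1)[OF this] show False using s by auto
      qed
    qed
    then show ?thesis by simp
  qed
qed

lemma not_arc_transitive: "\<not> arc_transitive X"
proof
  assume "arc_transitive X"
  then obtain g where g: "g \<in> automorphisms X" "g (vtx 0 0) = vtx 0 0" "g (vtx 1 1) = vtx (-1) (1 * S (-1) 0)"
    by (rule arc_transitive_base[of "-1" 1]) auto
  have "antipodal (vtx 0 0) (vtx 2 (1 + s * r))" unfolding antipodal_base by (intro bexI[of _ 1]) auto
  from antipodal_automorphism[OF g(1) this]
  obtain e where e: "e \<in> {1, -1}" "g (vtx 2 (1 + s * r)) = vtx 2 (e * (1 + s * r))"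
    unfolding g(2) antipodal_base by blast
  \<comment> \<open>Multiplication by the sign \<open>e\<close> brings the antipode back, so
    \<open>h \<circ> g\<close> fixes the chain vertex next to \<open>vtx 0 0\<close> but still moves
    \<open>vtx 1 1\<close> to level -1.\<close>
  obtain h where h: "h \<in> automorphisms X"
    "\<And>i j. even (i + j) \<Longrightarrow> h (vtx i j) = vtx (i + 0) (e * r ^ nat (0 mod 4) * j + 0)"
    by (rule rotation[of 0 0 e]) (use e in auto)
  have ev: "even (e * (1 + s * r))" using odd_r s by auto
  have "e * (e * (1 + s * r)) = 1 + s * r" using e(1) by auto
  moreover have "h (vtx 2 (e * (1 + s * r))) = vtx 2 (e * (e * (1 + s * r)))"
    using h(2)[of 2 "e * (1 + s * r)"] ev by simp
  ultimately have "(h \<circ> g) (vtx 2 (1 + s * r)) = vtx 2 (1 + s * r)" by (simp only: o_apply e(2))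
  moreover have "(h \<circ> g) (vtx 0 0) = vtx 0 0" using h(2)[of 0 0] by (simp add: g(2))
  ultimately have "(h \<circ> g) (vtx 1 1) = vtx 1 1"
    using fixes_up_arc[OF automorphisms_comp[OF h(1) g(1)]] by blast
  moreover have "(h \<circ> g) (vtx 1 1) = vtx (-1) (e * r ^ 3)" using h(2)[of "-1" "r ^ 3"] odd_r by (simp add: g(3))
  ultimately have "[1 = -1] (mod (4::int))" using vtx_eq_iff by metis
  then show False by (simp add: cong_def)
qed

end

section \<open>Counting 8-cycles\<close>

text \<open>Walks without backtracking that have just come from \<open>u\<close> to
  \<open>w\<close>, have \<open>m\<close> steps left and end at \<open>y\<close>. The last step must
  not come from \<open>v\<close>, so that continuing from \<open>y\<close> to \<open>v\<close> is no
  backtracking either.\<close>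

primrec walks :: "'a pair_pre_digraph \<Rightarrow> 'a \<Rightarrow> 'a \<Rightarrow> nat \<Rightarrow> 'a \<Rightarrow> 'a \<Rightarrow> nat" where
  "walks G v y 0 u w = (if w = y \<and> u \<noteq> v then 1 else 0)"
| "walks G v y (Suc m) u w = (\<Sum>z\<in>{z. (w, z) \<in> parcs G \<and> z \<noteq> u}. walks G v y m w z)"

text \<open>
  For \<open>f = (\<lambda>x. x)\<close> the following is the number of closed walks of length 8 without backtracking
  that run through \<open>y\<close>, \<open>v\<close>, \<open>x\<close> in this order.
\<close>

definition cycle_weight :: "(nat \<Rightarrow> nat) \<Rightarrow> 'a pair_pre_digraph \<Rightarrow> 'a \<Rightarrow> 'a \<Rightarrow> 'a \<Rightarrow> nat" where
  "cycle_weight f G v x y = (\<Sum>z\<in>{z. (x, z) \<in> parcs G \<and> z \<noteq> v}. f (walks G v y 5 x z))"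

lemma neighbours_automorphism:
  assumes g: "g \<in> automorphisms G" and G: "parcs G \<subseteq> pverts G \<times> pverts G" and w: "w \<in> pverts G"
  shows "{z. (g w, z) \<in> parcs G \<and> z \<noteq> g u} = g ` {z. (w, z) \<in> parcs G \<and> z \<noteq> u}"
proof -
  have arc: "(g w, g z) \<in> parcs G \<longleftrightarrow> (w, z) \<in> parcs G" for z
  proof (cases "z \<in> pverts G")
    case False
    then have "g z \<notin> pverts G" using automorphisms_vert_iff[OF g] by simp
    with False G show ?thesis by blast
  qed (simp add: automorphisms_arc_iff[OF g w])
  have surj: "\<exists>x. z = g x" for z
    using automorphisms_permutes[OF g] by (metis permutes_inverses(1))
  show ?thesis
  proof (intro equalityI subsetI)
    fix z assume "z \<in> {z. (g w, z) \<in> parcs G \<and> z \<noteq> g u}"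
    moreover obtain x where "z = g x" using surj by blast
    ultimately show "z \<in> g ` {z. (w, z) \<in> parcs G \<and> z \<noteq> u}" using arc by auto
  next
    fix z assume "z \<in> g ` {z. (w, z) \<in> parcs G \<and> z \<noteq> u}"
    then show "z \<in> {z. (g w, z) \<in> parcs G \<and> z \<noteq> g u}"
      using arc automorphisms_eq_iff[OF g] by auto
  qed
qed

lemma sum_neighbours_automorphism:
  assumes g: "g \<in> automorphisms G" and G: "parcs G \<subseteq> pverts G \<times> pverts G" and w: "w \<in> pverts G"
  shows "(\<Sum>z\<in>{z. (g w, z) \<in> parcs G \<and> z \<noteq> g u}. h z) = (\<Sum>z\<in>{z. (w, z) \<in> parcs G \<and> z \<noteq> u}. h (g z))"
  unfolding neighbours_automorphism[OF assms]
  by (subst sum.reindex) (auto simp: inj_on_def automorphisms_eq_iff[OF g])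

lemma walks_automorphism:
  assumes g: "g \<in> automorphisms G" and G: "parcs G \<subseteq> pverts G \<times> pverts G"
  shows "w \<in> pverts G \<Longrightarrow> walks G (g v) (g y) m (g u) (g w) = walks G v y m u w"
proof (induction m arbitrary: u w)
  case 0
  then show ?case by (simp add: automorphisms_eq_iff[OF g])
next
  case (Suc m)
  show ?case
    unfolding walks.simps sum_neighbours_automorphism[OF g G Suc.prems]
    by (rule sum.cong) (use G Suc.IH in auto)
qed

lemma cycle_weight_automorphism:
  assumes g: "g \<in> automorphisms G" and G: "parcs G \<subseteq> pverts G \<times> pverts G" and x: "x \<in> pverts G"
  shows "cycle_weight f G (g v) (g x) (g y) = cycle_weight f G v x y"
  unfolding cycle_weight_def sum_neighbours_automorphism[OF g G x]
  by (rule sum.cong) (use G walks_automorphism[OF g G] in auto)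

context metacirculant_component
begin

text \<open>Weights are invariant under automorphisms and tell whether two neighbours of a vertex
  lie on one level. Rotations reduce every pair of neighbours to a pair at the base vertex whose
  first member has sign 1.\<close>

lemma sides_preserved_if_weights:
  assumes base: "\<And>d d' e'. d \<in> {1, -1} \<Longrightarrow> d' \<in> {1, -1} \<Longrightarrow> e' \<in> {1, -1} \<Longrightarrow> (d, 1) \<noteq> (d', e') \<Longrightarrow>
      cycle_weight f X (vtx 0 0) (vtx d (1 * S d 0)) (vtx d' (e' * S d' 0)) \<in> W \<longleftrightarrow> d = d'"
    and g: "g \<in> automorphisms X" and vxy: "same_side v x y"
  shows "same_side (g v) (g x) (g y)"
proof -
  obtain i j d e where h: "even (i + j)" "d \<in> {1, -1}" "e \<in> {1, -1}" "v = vtx i j"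
    "x = vtx (i + d) (j + e * S d i)" "y = vtx (i + d) (j - e * S d i)"
    using vxy unfolding same_side_def by blast
  have me: "- e \<in> {1, -1}" using h(3) by auto
  have arc: "(v, x) \<in> parcs X" "(v, y) \<in> parcs X"
    using vtx_arc[OF h(1-3)] vtx_arc[OF h(1,2) me] by (simp_all add: h)
  have weights: "cycle_weight f X v x' y' \<in> W \<longleftrightarrow> d1 = d2"
    if ev: "even (i + j)" and v: "v = vtx i j"
      and 1: "d1 \<in> {1, -1}" "e1 \<in> {1, -1}" "x' = vtx (i + d1) (j + e1 * S d1 i)"
      and 2: "d2 \<in> {1, -1}" "e2 \<in> {1, -1}" "y' = vtx (i + d2) (j + e2 * S d2 i)"
      and ne: "(d1, e1) \<noteq> (d2, e2)" for i j v x' y' d1 e1 d2 e2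
  proof -
    obtain k where k: "k \<in> automorphisms X" "k (vtx 0 0) = vtx i j"
      "\<And>d e. d \<in> {1, -1} \<Longrightarrow> e \<in> {1, -1} \<Longrightarrow> k (vtx d (e * S d 0)) = vtx (i + d) (j + e1 * e * S d i)"
      by (rule rotation_base[OF ev 1(2)]) auto
    have "even (d1 + 1 * S d1 0)" using 1 by auto
    note x = vtx_in_verts[OF this]
    have p1: "1 \<in> {1, -1 :: int}" by simp
    have ee: "e1 * e2 \<in> {1, -1}" "e1 * (e1 * e2) = e2" using 1(2) 2(2) by auto
    have ne': "(d1, 1) \<noteq> (d2, e1 * e2)" using ne 1(2) 2(2) by auto
    have kx: "k (vtx d1 (1 * S d1 0)) = x'" using k(3)[OF 1(1) p1] by (simp add: 1(3))
    have ky: "k (vtx d2 (e1 * e2 * S d2 0)) = y'" using k(3)[OF 2(1) ee(1)] ee(2) by (simp only: 2(3))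
    show ?thesis
      using cycle_weight_automorphism[OF k(1) arcs_subset x, of f "vtx 0 0" "vtx d2 (e1 * e2 * S d2 0)"]
        base[OF 1(1) 2(1) ee(1) ne'] by (simp only: k(2) kx ky v)
  qed
  have xv: "x \<in> pverts X" "v \<in> pverts X" "y \<in> pverts X" using arc arcs_subset by auto
  have "cycle_weight f X v x y \<in> W"
    using weights[OF h(1,4) h(2,3,5) h(2) me] h(3,6) by auto
  then have w: "cycle_weight f X (g v) (g x) (g y) \<in> W"
    by (simp add: cycle_weight_automorphism[OF g arcs_subset xv(1)])
  have garc: "(g v, g x) \<in> parcs X" "(g v, g y) \<in> parcs X"
    using arc xv automorphisms_arc_iff[OF g] by simp_all
  obtain i' j' where v': "g v = vtx i' j'" "even (i' + j')"
    using automorphisms_vert_iff[OF g, of v] xv unfolding verts by auto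
  obtain d1 e1 where 1: "d1 \<in> {1, -1}" "e1 \<in> {1, -1}" "g x = vtx (i' + d1) (j' + e1 * S d1 i')"
    using garc(1) unfolding v'(1) neighbours[OF v'(2)] by blast
  obtain d2 e2 where 2: "d2 \<in> {1, -1}" "e2 \<in> {1, -1}" "g y = vtx (i' + d2) (j' + e2 * S d2 i')"
    using garc(2) unfolding v'(1) neighbours[OF v'(2)] by blast
  have "x \<noteq> y" using step_eq_iff[OF h(2,3) h(2) me, of i j] h(3) by (auto simp: h)
  then have ne: "(d1, e1) \<noteq> (d2, e2)" using 1(3) 2(3) automorphisms_eq_iff[OF g, of x y] by auto
  have d: "d2 = d1" using weights[OF v'(2,1) 1 2 ne] w by simp
  then have "e2 = - e1" using ne 1(2) 2(2) by auto
  then show ?thesis unfolding v'(1) 1(3) same_side_iff[OF v'(2) 1(1,2)] by (simp add: 2(3) d)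
qed

end

text \<open>
  Walks are enumerated symbolically: a displacement \<open>c0 + c1 r + c2 r\<^sup>2 + c3 r\<^sup>3\<close> is represented by
  its coefficients, a step by the change of the level and the sign of the displacement.
\<close>

fun bump :: "int \<Rightarrow> int \<Rightarrow> int \<times> int \<times> int \<times> int \<Rightarrow> int \<times> int \<times> int \<times> int" where
  "bump m e (c0, c1, c2, c3) =
    (if m = 0 then (c0 + e, c1, c2, c3) else if m = 1 then (c0, c1 + e, c2, c3)
     else if m = 2 then (c0, c1, c2 + e, c3) else (c0, c1, c2, c3 + e))"

definition steps :: "(int \<times> int) list" where
  "steps = [(1, 1), (1, -1), (-1, 1), (-1, -1)]"

definition step_level :: "int \<times> int \<Rightarrow> int \<Rightarrow> int" where
  "step_level s L = (if fst s = 1 then L mod 4 else (L - 1) mod 4)"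

text \<open>The symbolic counterpart of \<open>walks\<close>: \<open>s\<close> is the last step
  made, \<open>L\<close> the level, and \<open>c\<close> the displacement relative to the end point,
  the neighbour of \<open>vtx 0 0\<close> in the step \<open>t\<close>. \<open>Q\<close> stands for
  divisibility by \<open>n\<close>, and \<open>s \<noteq> t\<close> forbids arriving from
  \<open>vtx 0 0\<close>.\<close>

primrec words :: "(int \<times> int \<times> int \<times> int \<Rightarrow> bool) \<Rightarrow> int \<times> int \<Rightarrow> nat \<Rightarrow> int \<times> int \<Rightarrow> int \<Rightarrow>
    int \<times> int \<times> int \<times> int \<Rightarrow> nat" where
  "words Q t 0 s L c = (if L = fst t mod 4 \<and> s \<noteq> t then if Q c then 1 else 0 else 0)"
| "words Q t (Suc m) s L c =
    (\<Sum>s'\<leftarrow>steps. if s' = (- fst s, - snd s) then 0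
       else words Q t m s' ((L + fst s') mod 4) (bump (step_level s' L) (snd s') c))"

definition word_weight :: "(nat \<Rightarrow> nat) \<Rightarrow> (int \<times> int \<times> int \<times> int \<Rightarrow> bool) \<Rightarrow> int \<times> int \<Rightarrow> int \<times> int \<Rightarrow> nat" where
  "word_weight f Q s t =
    (\<Sum>s'\<leftarrow>steps. if s' = (- fst s, - snd s) then 0
       else f (words Q t 5 s' ((fst s mod 4 + fst s') mod 4) (bump (step_level s' (fst s mod 4)) (snd s')
         (bump (step_level s 0) (snd s) (bump (step_level t 0) (- snd t) (0, 0, 0, 0))))))"

lemma words_mono:
  assumes "\<And>c. Q c \<Longrightarrow> Q' c"
  shows "words Q t m s L c \<le> words Q' t m s L c"
  by (induction m arbitrary: s L c) (auto simp: assms intro!: sum_list_mono)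

text \<open>Replacing divisibility by \<open>n\<close> with a weaker or a stronger condition on the
  coefficients bounds the true weight from above or from below.\<close>

lemma word_weight_mono:
  assumes "\<And>c. Q c \<Longrightarrow> Q' c" "mono f"
  shows "word_weight f Q s t \<le> word_weight f Q' s t"
  unfolding word_weight_def
  by (intro sum_list_mono) (auto intro!: monoD[OF assms(2)] words_mono assms(1))

section \<open>Agreement of the numbers of walks with the symbolic counts\<close>

context metacirculant_component
begin

fun displacement :: "int \<times> int \<times> int \<times> int \<Rightarrow> int" where
  "displacement (c0, c1, c2, c3) = c0 + c1 * r + c2 * r ^ 2 + c3 * r ^ 3"

definition move :: "int \<times> int \<Rightarrow> int \<Rightarrow> int \<Rightarrow> 'a" where
  "move s L J = vtx (L + fst s) (J + snd s * S (fst s) L)"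

lemma set_steps: "s \<in> set steps \<longleftrightarrow> fst s \<in> {1, -1} \<and> snd s \<in> {1, -1}"
  by (cases s) (auto simp: steps_def)

lemma uminus_steps: "s \<in> set steps \<Longrightarrow> (- fst s, - snd s) \<in> set steps"
  by (auto simp: set_steps)

lemma displacement_bump:
  "displacement (bump (step_level s L) e c) = displacement c + e * S (fst s) L"
proof (cases c)
  case (fields c0 c1 c2 c3)
  have "step_level s L \<in> {0, 1, 2, 3}" unfolding step_level_def by auto
  moreover have "S (fst s) L = r ^ nat (step_level s L)" by (simp add: step_level_def step_coeff_def)
  ultimately show ?thesis unfolding fields
    by (elim insertE emptyE) (simp_all add: algebra_simps)
qed

lemma move_eq_iff:
  assumes "s \<in> set steps" "s' \<in> set steps"
  shows "move s L J = move s' L J \<longleftrightarrow> s = s'"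
  using assms step_eq_iff[of "fst s" "snd s" "fst s'" "snd s'" L J]
  by (simp add: set_steps move_def prod_eq_iff)

lemma move_cong:
  assumes "vtx L J = vtx L' J'"
  shows "move s L J = move s L' J'"
proof -
  have c: "[L = L'] (mod 4)" "[J = J'] (mod n)" using assms by (auto simp: vtx_eq_iff)
  show ?thesis unfolding move_def vtx_eq_iff S_cong[OF c(1), of "fst s"]
    by (intro conjI cong_add c cong_refl)
qed

lemma neighbours_move:
  assumes "even (L + J)"
  shows "(vtx L J, z) \<in> parcs X \<longleftrightarrow> z \<in> (\<lambda>s. move s L J) ` set steps"
  unfolding neighbours[OF assms] by (auto simp: steps_def move_def)

text \<open>Different steps lead to different neighbours, so a sum over neighbours is a sum over the
  list of four steps.\<close>

lemma sum_neighbours_move: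
  assumes "even (L + J)" and s0: "s0 \<in> set steps"
  shows "(\<Sum>z\<in>{z. (vtx L J, z) \<in> parcs X \<and> z \<noteq> move s0 L J}. h z) =
    (\<Sum>s\<leftarrow>steps. if s = s0 then 0 else h (move s L J))"
proof -
  have eq: "move s L J = move s0 L J \<longleftrightarrow> s = s0" if "s \<in> set steps" for s
    by (rule move_eq_iff[OF that s0])
  have "{s \<in> set steps. move s L J \<noteq> move s0 L J} = set steps - {s0}"
    using eq by auto
  moreover have "{z. (vtx L J, z) \<in> parcs X \<and> z \<noteq> move s0 L J} =
      (\<lambda>s. move s L J) ` {s \<in> set steps. move s L J \<noteq> move s0 L J}"
    by (auto simp: neighbours_move[OF assms(1)])
  ultimately have "{z. (vtx L J, z) \<in> parcs X \<and> z \<noteq> move s0 L J} = (\<lambda>s. move s L J) ` (set steps - {s0})"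
    by simp
  moreover have "inj_on (\<lambda>s. move s L J) (set steps - {s0})"
    by (rule inj_onI) (simp add: move_eq_iff)
  ultimately have "(\<Sum>z\<in>{z. (vtx L J, z) \<in> parcs X \<and> z \<noteq> move s0 L J}. h z) =
      (\<Sum>s\<in>set steps - {s0}. h (move s L J))"
    by (simp add: sum.reindex)
  also have "\<dots> = (\<Sum>s\<in>set steps. if s = s0 then 0 else h (move s L J))"
    by (rule sum.mono_neutral_cong_left) auto
  also have "\<dots> = (\<Sum>s\<leftarrow>steps. if s = s0 then 0 else h (move s L J))"
    by (rule sum_list_distinct_conv_sum_set[symmetric]) (simp add: steps_def)
  finally show ?thesis .
qed

text \<open>\<open>walks\<close> records the previous vertex, \<open>words\<close> the last step;
  the second equation recovers the former by reversing the latter.\<close>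

lemma move_step:
  assumes "s \<in> set steps"
  shows "move s L J = vtx ((L + fst s) mod 4) (J + snd s * S (fst s) L)"
    "vtx L J = move (- fst s, - snd s) ((L + fst s) mod 4) (J + snd s * S (fst s) L)"
proof -
  have "[(L + fst s) mod 4 = L + fst s] (mod 4)" by simp
  from S_cong[OF this, of "- fst s"] have "S (- fst s) ((L + fst s) mod 4) = S (fst s) L"
    using S_inverse[of "fst s" L] assms by (simp add: set_steps)
  then show "vtx L J = move (- fst s, - snd s) ((L + fst s) mod 4) (J + snd s * S (fst s) L)"
    by (simp add: move_def vtx_eq_iff cong_def mod_diff_left_eq)
  show "move s L J = vtx ((L + fst s) mod 4) (J + snd s * S (fst s) L)"
    by (simp add: move_def vtx_eq_iff)
qed

text \<open>The displacement \<open>c\<close> is measured from the end point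
  \<open>move t 0 0\<close>, whence the offset in the assumption on \<open>J\<close>.\<close>

lemma walks_eq_words:
  assumes t: "t \<in> set steps"
  shows "s \<in> set steps \<Longrightarrow> L mod 4 = L \<Longrightarrow> even (L + J) \<Longrightarrow> J = displacement c + snd t * S (fst t) 0 \<Longrightarrow>
    walks X (vtx 0 0) (move t 0 0) m (move (- fst s, - snd s) L J) (vtx L J) =
    words (\<lambda>c. n dvd displacement c) t m s L c"
proof (induction m arbitrary: s L J c)
  case 0
  have yt: "move t 0 0 = vtx (fst t mod 4) (snd t * S (fst t) 0)"
    "vtx 0 0 = move (- fst t, - snd t) (fst t mod 4) (snd t * S (fst t) 0)"
    using move_step[OF t, of 0 0] by simp_all
  have eq: "vtx L J = move t 0 0 \<longleftrightarrow> L = fst t mod 4 \<and> n dvd displacement c"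
  proof -
    have "[L = fst t mod 4] (mod 4) \<longleftrightarrow> L = fst t mod 4" by (simp add: cong_def 0(2))
    moreover have "[J = snd t * S (fst t) 0] (mod n) \<longleftrightarrow> n dvd displacement c"
      by (simp add: 0(4) cong_iff_dvd_diff)
    ultimately show ?thesis unfolding yt(1) vtx_eq_iff by (simp only:)
  qed
  have "move (- fst s, - snd s) L J \<noteq> vtx 0 0 \<longleftrightarrow> s \<noteq> t" if "vtx L J = move t 0 0"
  proof -
    have "move (- fst s, - snd s) L J = move (- fst s, - snd s) (fst t mod 4) (snd t * S (fst t) 0)"
      by (rule move_cong) (simp only: that yt(1))
    then show ?thesis
      unfolding yt(2) using move_eq_iff[OF uminus_steps[OF 0(1)] uminus_steps[OF t]]
      by (simp add: prod_eq_iff)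
  qed
  then show ?case using eq by auto
next
  case (Suc m)
  have "walks X (vtx 0 0) (move t 0 0) (Suc m) (move (- fst s, - snd s) L J) (vtx L J) =
      (\<Sum>s'\<leftarrow>steps. if s' = (- fst s, - snd s) then 0
        else walks X (vtx 0 0) (move t 0 0) m (vtx L J) (move s' L J))"
    unfolding walks.simps by (rule sum_neighbours_move[OF Suc.prems(3) uminus_steps[OF Suc.prems(1)]])
  also have "\<dots> = words (\<lambda>c. n dvd displacement c) t (Suc m) s L c"
    unfolding words.simps
  proof (intro arg_cong[where f = sum_list] map_cong refl if_cong)
    fix s' assume s': "s' \<in> set steps"
    show "walks X (vtx 0 0) (move t 0 0) m (vtx L J) (move s' L J) =
        words (\<lambda>c. n dvd displacement c) t m s' ((L + fst s') mod 4) (bump (step_level s' L) (snd s') c)"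
      unfolding move_step(1)[OF s'] move_step(2)[OF s', of L J]
    proof (rule Suc.IH[OF s'])
      have ds: "fst s' \<in> {1, -1}" "snd s' \<in> {1, -1}" using s' by (auto simp: set_steps)
      have "even (L + fst s' + (J + snd s' * S (fst s') L))" by (rule even_step[OF Suc.prems(3) ds])
      then show "even ((L + fst s') mod 4 + (J + snd s' * S (fst s') L))"
        by (metis dvd_mod_iff even_add even_numeral)
      show "J + snd s' * S (fst s') L =
          displacement (bump (step_level s' L) (snd s') c) + snd t * S (fst t) 0"
        by (simp add: displacement_bump Suc.prems(4))
    qed simp
  qed
  finally show ?case .
qed

lemma cycle_weight_eq_word_weight:
  assumes s: "s \<in> set steps" and t: "t \<in> set steps"
  shows "cycle_weight f X (vtx 0 0) (move s 0 0) (move t 0 0) =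
    word_weight f (\<lambda>c. n dvd displacement c) s t"
proof -
  define J where "J = snd s * S (fst s) 0"
  have x: "move s 0 0 = vtx (fst s mod 4) J" "vtx 0 0 = move (- fst s, - snd s) (fst s mod 4) J"
    using move_step[OF s, of 0 0] by (simp_all add: J_def)
  define c where "c = bump (step_level s 0) (snd s) (bump (step_level t 0) (- snd t) (0, 0, 0, 0))"
  have Jc: "J = displacement c + snd t * S (fst t) 0" unfolding c_def J_def displacement_bump by simp
  have ev: "even (fst s mod 4 + J)" using s unfolding set_steps J_def by auto
  have "cycle_weight f X (vtx 0 0) (move s 0 0) (move t 0 0) =
      (\<Sum>z\<in>{z. (vtx (fst s mod 4) J, z) \<in> parcs X \<and> z \<noteq> move (- fst s, - snd s) (fst s mod 4) J}.
        f (walks X (vtx 0 0) (move t 0 0) 5 (vtx (fst s mod 4) J) z))"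
    unfolding cycle_weight_def x(1) x(2)[symmetric] ..
  also have "\<dots> = (\<Sum>s'\<leftarrow>steps. if s' = (- fst s, - snd s) then 0
      else f (walks X (vtx 0 0) (move t 0 0) 5 (vtx (fst s mod 4) J) (move s' (fst s mod 4) J)))"
    by (rule sum_neighbours_move[OF ev uminus_steps[OF s]])
  also have "\<dots> = word_weight f (\<lambda>c. n dvd displacement c) s t"
    unfolding word_weight_def c_def[symmetric]
  proof (intro arg_cong[where f = sum_list] map_cong refl if_cong arg_cong[where f = f])
    fix s' assume s': "s' \<in> set steps"
    show "walks X (vtx 0 0) (move t 0 0) 5 (vtx (fst s mod 4) J) (move s' (fst s mod 4) J) =
        words (\<lambda>c. n dvd displacement c) t 5 s' ((fst s mod 4 + fst s') mod 4)
          (bump (step_level s' (fst s mod 4)) (snd s') c)"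
      unfolding move_step(1)[OF s'] move_step(2)[OF s', of "fst s mod 4" J]
    proof (rule walks_eq_words[OF t s'])
      have ds: "fst s' \<in> {1, -1}" "snd s' \<in> {1, -1}" using s' by (auto simp: set_steps)
      have "even (fst s mod 4 + fst s' + (J + snd s' * S (fst s') (fst s mod 4)))"
        by (rule even_step[OF ev ds])
      then show "even ((fst s mod 4 + fst s') mod 4 + (J + snd s' * S (fst s') (fst s mod 4)))"
        by (metis dvd_mod_iff even_add even_numeral)
      show "J + snd s' * S (fst s') (fst s mod 4) =
          displacement (bump (step_level s' (fst s mod 4)) (snd s') c) + snd t * S (fst t) 0"
        by (simp add: displacement_bump Jc)
    qed simp
  qed
  finally show ?thesis .
qed

end

text \<open>
  Upper and lower approximations of the divisibility of a displacement by \<open>n\<close>, in terms of the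
  coefficients of \<open>A + B r\<close> and \<open>a + b r\<close>.  The coefficients of a closed walk always have equal
  parity, so that it does not matter what is done with the others.
\<close>

fun possible :: "(int \<Rightarrow> int \<Rightarrow> int \<Rightarrow> int \<Rightarrow> bool) \<Rightarrow> int \<times> int \<times> int \<times> int \<Rightarrow> bool" where
  "possible P (c0, c1, c2, c3) \<longleftrightarrow> (even (c0 + c1) \<and> even (c0 + c2) \<and> even (c1 + c3) \<longrightarrow>
    P ((c0 + c2) div 2) ((c1 + c3) div 2) ((c0 - c2) div 2) ((c1 - c3) div 2))"

fun certain :: "(int \<Rightarrow> int \<Rightarrow> int \<Rightarrow> int \<Rightarrow> bool) \<Rightarrow> int \<times> int \<times> int \<times> int \<Rightarrow> bool" where
  "certain P (c0, c1, c2, c3) \<longleftrightarrow> even (c0 + c1) \<and> even (c0 + c2) \<and> even (c1 + c3) \<and>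
    P ((c0 + c2) div 2) ((c1 + c3) div 2) ((c0 - c2) div 2) ((c1 - c3) div 2)"

text \<open>Meant for \<open>Q\<close> necessary and \<open>Q'\<close> sufficient for a walk to
  close: the true number of closed walks is then at most \<open>N\<close> exactly when the two
  neighbours lie on one level. By symmetry the first neighbour may be given the sign 1.\<close>

definition separated :: "(int \<times> int \<times> int \<times> int \<Rightarrow> bool) \<Rightarrow> (int \<times> int \<times> int \<times> int \<Rightarrow> bool) \<Rightarrow> nat \<Rightarrow> bool" where
  "separated Q Q' N \<longleftrightarrow> list_all (\<lambda>d. list_all (\<lambda>t. (d, 1) = t \<or>
    (if d = fst t then word_weight (\<lambda>x. x) Q (d, 1) t \<le> N else N < word_weight (\<lambda>x. x) Q' (d, 1) t))
    steps) [1, -1]"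

text \<open>
  For \<open>n = 80\<close>, two neighbours on one level are on 10 common 8-cycles, but so are some pairs of
  neighbours on different levels.  Adding the squares of the numbers of 8-cycles through the
  extensions to a path of length 3 gives 34 or 36 in the former case, and 27, 29 or 38 in the latter.
\<close>

definition separated_squares :: "(int \<times> int \<times> int \<times> int \<Rightarrow> bool) \<Rightarrow> bool" where
  "separated_squares Q \<longleftrightarrow> list_all (\<lambda>d. list_all (\<lambda>t. (d, 1) = t \<or>
    (word_weight (\<lambda>x. x * x) Q (d, 1) t \<in> {34, 36} \<longleftrightarrow> d = fst t)) steps) [1, -1]"

text \<open>
  Necessary conditions for \<open>k dvd A + B * r\<close> (if \<open>k \<ge> 12\<close> and \<open>r \<noteq> \<plusminus>1\<close> modulo \<open>k\<close>) and for
  \<open>l dvd a + b * r\<close> (if \<open>l \<ge> 13\<close>), from \<open>k dvd A\<^sup>2 - B\<^sup>2\<close> and \<open>l dvd a\<^sup>2 + b\<^sup>2\<close>.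
\<close>

definition small_k :: "int \<Rightarrow> int \<Rightarrow> bool" where
  "small_k A B \<longleftrightarrow> even (A + B) \<and> (A = 0 \<longrightarrow> B = 0 \<or> 8 \<le> \<bar>B\<bar>) \<and> (B = 0 \<longrightarrow> A = 0 \<or> 8 \<le> \<bar>A\<bar>) \<and>
    \<not> (\<bar>A\<bar> = 1 \<and> \<bar>B\<bar> = 1) \<and> \<not> (\<bar>A\<bar> = 1 \<and> \<bar>B\<bar> = 3) \<and> \<not> (\<bar>A\<bar> = 3 \<and> \<bar>B\<bar> = 1)"

definition small_l :: "int \<Rightarrow> int \<Rightarrow> bool" where
  "small_l a b \<longleftrightarrow> a = 0 \<and> b = 0 \<or>
    13 \<le> a * a + b * b \<and> (a = 0 \<longrightarrow> 13 \<le> \<bar>b\<bar>) \<and> (b = 0 \<longrightarrow> 13 \<le> \<bar>a\<bar>)"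

text \<open>For \<open>k \<ge> 12\<close> and \<open>l \<ge> 13\<close>; the only walks certain to
  close are those whose coefficients all vanish.\<close>

lemma separated_generic:
  "separated (possible (\<lambda>A B a b. small_l a b \<and> small_k A B))
    (certain (\<lambda>A B a b. A = 0 \<and> B = 0 \<and> a = 0 \<and> b = 0)) 4"
  by code_simp

text \<open>For \<open>k = 8\<close>: without 4-cycles \<open>r\<close> is 3 or 5 modulo 8, and a
  change of sign makes it 3.\<close>

lemma separated_k8:
  "separated (possible (\<lambda>A B a b. small_l a b \<and> 8 dvd A + B * 3))
    (certain (\<lambda>A B a b. 8 dvd A + B * 3 \<and> a = 0 \<and> b = 0)) 5"
  by code_simp

text \<open>For \<open>l = 5\<close>, with \<open>r\<close> normalised to 2 modulo 5, when
  \<open>k\<close> does not divide \<open>2 + 2 * r\<close>. The variant with \<open>B = - A\<close>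
  is for \<open>k\<close> not dividing \<open>2 - 2 * r\<close>.\<close>

lemma separated_l5_plus:
  "separated (possible (\<lambda>A B a b. 5 dvd a + b * 2 \<and> small_k A B \<and> \<not> (\<bar>A\<bar> = 2 \<and> B = A)))
    (certain (\<lambda>A B a b. 5 dvd a + b * 2 \<and> A = 0 \<and> B = 0)) 5"
  by code_simp

lemma separated_l5_minus:
  "separated (possible (\<lambda>A B a b. 5 dvd a + b * 2 \<and> small_k A B \<and> \<not> (\<bar>A\<bar> = 2 \<and> B = - A)))
    (certain (\<lambda>A B a b. 5 dvd a + b * 2 \<and> A = 0 \<and> B = 0)) 5"
  by code_simp

fun divides_80 :: "int \<Rightarrow> int \<times> int \<times> int \<times> int \<Rightarrow> bool" where
  "divides_80 q (c0, c1, c2, c3) \<longleftrightarrow> (c0 + q * (c1 + q * (c2 + q * c3))) mod 80 = 0"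

text \<open>The residues modulo 80 that are 3 modulo 8 and 2 or 3 modulo 5 are 3, 27, 43 and
  67.\<close>

lemma separated_80_3: "separated_squares (divides_80 3)"
  by code_simp

lemma separated_80_27: "separated_squares (divides_80 27)"
  by code_simp

lemma separated_80_43: "separated_squares (divides_80 43)"
  by code_simp

lemma separated_80_67: "separated_squares (divides_80 67)"
  by code_simp

section \<open>Reduction to the enumerated cases of \<open>k\<close>, \<open>l\<close> and the
  residue of \<open>r\<close>\<close>

context metacirculant_component
begin

text \<open>Replacing \<open>r\<close> by \<open>- r\<close> only changes signs of step
  coefficients, and every step occurs with both signs. This serves to normalise the residue of
  \<open>r\<close>.\<close>

lemma uminus: "metacirculant_component n1 (- r) X vtx"
proof
  show "[(- r) ^ 4 = 1] (mod n)" using r4 by simp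
  have "\<exists>f\<in>{1, -1}. f * step_coeff (- r) d i = e * S d i" "\<exists>f\<in>{1, -1}. f * S d i = e * step_coeff (- r) d i"
    if e: "e \<in> {1, -1}" for e d i
  proof -
    define m where "m = nat ((if d = 1 then i else i - 1) mod 4)"
    have m: "step_coeff (- r) d i = (- 1) ^ m * S d i"
      unfolding step_coeff_def m_def[symmetric] by (rule power_minus)
    have "(- 1 :: int) ^ m \<in> {1, -1}" by (cases "even m") simp_all
    then show "\<exists>f\<in>{1, -1}. f * step_coeff (- r) d i = e * S d i" "\<exists>f\<in>{1, -1}. f * S d i = e * step_coeff (- r) d i"
      unfolding m using e by auto
  qed
  note signs = this
  let ?arc = "\<lambda>i j d x. (vtx i j, vtx (i + d) (j + x))"
  show "parcs X = {?arc i j d (e * step_coeff (- r) d i) | i j d e.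
    even (i + j) \<and> d \<in> {1, -1} \<and> e \<in> {1, -1}}"
  proof (intro equalityI subsetI)
    fix a assume "a \<in> parcs X"
    then obtain i j d e where h: "a = ?arc i j d (e * S d i)" "even (i + j)" "d \<in> {1, -1}" "e \<in> {1, -1}"
      unfolding arcs by blast
    obtain f where f: "f \<in> {1, -1}" "f * step_coeff (- r) d i = e * S d i" using signs(1)[OF h(4)] by blast
    have "a = ?arc i j d (f * step_coeff (- r) d i)" by (simp only: h(1) f(2))
    then show "a \<in> {?arc i j d (e * step_coeff (- r) d i) | i j d e.
      even (i + j) \<and> d \<in> {1, -1} \<and> e \<in> {1, -1}}" using h(2,3) f(1) by blast
  next
    fix a assume "a \<in> {?arc i j d (e * step_coeff (- r) d i) | i j d e.
      even (i + j) \<and> d \<in> {1, -1} \<and> e \<in> {1, -1}}"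
    then obtain i j d e where h: "a = ?arc i j d (e * step_coeff (- r) d i)" "even (i + j)"
      "d \<in> {1, -1}" "e \<in> {1, -1}" by blast
    obtain f where f: "f \<in> {1, -1}" "f * S d i = e * step_coeff (- r) d i" using signs(2)[OF h(4)] by blast
    have "a = ?arc i j d (f * S d i)" by (simp only: h(1) f(2))
    then show "a \<in> parcs X" using vtx_arc[OF h(2,3) f(1)] by (simp only:)
  qed
qed (use n1_pos even_n1 vtx_eq_iff verts in simp_all)

end

context factored_component
begin

text \<open>The half sums and half differences solve \<open>c0 = A + a\<close>,
  \<open>c1 = B + b\<close>, \<open>c2 = A - a\<close>, \<open>c3 = B - b\<close>; the parity
  conditions make the halves exact and give the parity hypothesis of
  \<open>displacement_dvd_iff\<close>.\<close>

lemma possibleI: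
  assumes P: "\<And>A B a b. k dvd A + B * r \<Longrightarrow> l dvd a + b * r \<Longrightarrow> P A B a b"
    and c: "n dvd displacement c"
  shows "possible P c"
proof (cases c)
  case (fields c0 c1 c2 c3)
  show ?thesis unfolding fields possible.simps
  proof (intro impI, elim conjE)
    assume ev: "even (c0 + c1)" "even (c0 + c2)" "even (c1 + c3)"
    define A B a b where ABab: "A = (c0 + c2) div 2" "B = (c1 + c3) div 2"
      "a = (c0 - c2) div 2" "b = (c1 - c3) div 2"
    have h: "c0 = A + a" "c1 = B + b" "c2 = A - a" "c3 = B - b"
      unfolding ABab using ev(2,3) by presburger+
    have "n dvd c0 + c1 * r + c2 * r ^ 2 + c3 * r ^ 3" using c by (simp add: fields)
    moreover have "even (A + a + B + b)" using ev(1) unfolding h(1,2) by (simp add: add.assoc)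
    ultimately have "k dvd A + B * r" "l dvd a + b * r" using displacement_dvdD[OF _ h] by blast+
    then have "P A B a b" by (rule P)
    then show "P ((c0 + c2) div 2) ((c1 + c3) div 2) ((c0 - c2) div 2) ((c1 - c3) div 2)"
      by (simp only: ABab)
  qed
qed

lemma certainD:
  assumes P: "\<And>A B a b. P A B a b \<Longrightarrow> k dvd A + B * r \<and> l dvd a + b * r"
    and c: "certain P c"
  shows "n dvd displacement c"
proof (cases c)
  case (fields c0 c1 c2 c3)
  define A B a b where ABab: "A = (c0 + c2) div 2" "B = (c1 + c3) div 2"
    "a = (c0 - c2) div 2" "b = (c1 - c3) div 2"
  have ev: "even (c0 + c1)" "even (c0 + c2)" "even (c1 + c3)" and "P A B a b"
    using c unfolding fields certain.simps ABab by blast+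
  then have dvd: "k dvd A + B * r \<and> l dvd a + b * r" by (intro P)
  have h: "c0 = A + a" "c1 = B + b" "c2 = A - a" "c3 = B - b"
    unfolding ABab using ev(2,3) by presburger+
  have "even (A + a + B + b)" using ev(1) unfolding h(1,2) by (simp add: add.assoc)
  from displacement_dvd_iff[OF this] dvd show ?thesis by (simp add: fields h)
qed

text \<open>\<open>r ^ 2 = 1\<close> modulo \<open>n1\<close> would make \<open>l\<close> a divisor
  of 2, and \<open>r ^ 2 = -1\<close> would make \<open>k\<close> one.\<close>

lemma not_arc_transitive_if_sides_preserved:
  assumes "\<And>g v x y. g \<in> automorphisms X \<Longrightarrow> same_side v x y \<Longrightarrow> same_side (g v) (g x) (g y)"
  shows "\<not> arc_transitive X"
proof
  assume "arc_transitive X"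
  then have "\<exists>s\<in>{1, -1}. [r ^ 2 = s] (mod n1)"
  proof (rule square_if_sides_preserved[rotated])
    show "same_side (g v) (g x) (g y)" if "g \<in> automorphisms X" "same_side v x y" for g v x y
      using that by (rule assms)
  qed
  then obtain s where s: "s \<in> {1, -1}" "n1 dvd r ^ 2 - s"
    unfolding cong_iff_dvd_diff by blast
  have k: "k dvd r ^ 2 - s" and l: "l dvd r ^ 2 - s"
    using s(2) unfolding n1_eq by (auto dest: dvd_mult_left dvd_mult_right)
  from s(1) consider "s = 1" | "s = -1" by auto
  then show False
  proof cases
    case 1
    have "l dvd (r ^ 2 + 1) - (r ^ 2 - s)" using l_dvd l by (rule dvd_diff)
    then have "l dvd 2 * 1" by (simp add: 1)
    then have "l dvd 1" by (simp only: l_dvd_double)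
    then show False using l_gt by simp
  next
    case 2
    have "k dvd (r ^ 2 - s) - (r ^ 2 - 1)" using k k_dvd by (rule dvd_diff)
    then have "k dvd 2" by (simp add: 2)
    then show False using k_gt zdvd_imp_le[of k 2] by simp
  qed
qed

lemma not_arc_transitive_if_weights:
  assumes "\<And>d t. d \<in> {1, -1} \<Longrightarrow> t \<in> set steps \<Longrightarrow> (d, 1) \<noteq> t \<Longrightarrow>
    word_weight f (\<lambda>c. n dvd displacement c) (d, 1) t \<in> W \<longleftrightarrow> d = fst t"
  shows "\<not> arc_transitive X"
proof (rule not_arc_transitive_if_sides_preserved)
  fix g v x y assume "g \<in> automorphisms X" "same_side v x y"
  then show "same_side (g v) (g x) (g y)"
  proof (rule sides_preserved_if_weights[rotated])
    fix d d' e' :: int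
    assume h: "d \<in> {1, -1}" "d' \<in> {1, -1}" "e' \<in> {1, -1}" "(d, 1) \<noteq> (d', e')"
    have st: "(d, 1) \<in> set steps" "(d', e') \<in> set steps" using h by (auto simp: set_steps)
    show "cycle_weight f X (vtx 0 0) (vtx d (1 * S d 0)) (vtx d' (e' * S d' 0)) \<in> W \<longleftrightarrow> d = d'"
      using cycle_weight_eq_word_weight[OF st, of f] assms[OF h(1) st(2) h(4)]
      by (simp add: move_def)
  qed
qed

lemma not_arc_transitive_if_separated:
  assumes "separated (possible P) (certain P') N"
    and P: "\<And>A B a b. k dvd A + B * r \<Longrightarrow> l dvd a + b * r \<Longrightarrow> P A B a b"
    and P': "\<And>A B a b. P' A B a b \<Longrightarrow> k dvd A + B * r \<and> l dvd a + b * r"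
  shows "\<not> arc_transitive X"
proof (rule not_arc_transitive_if_weights[where f = "\<lambda>x. x" and W = "{..N}"])
  fix d :: int and t assume h: "d \<in> {1, -1}" "t \<in> set steps" "(d, 1) \<noteq> t"
  have sep: "if d = fst t then word_weight (\<lambda>x. x) (possible P) (d, 1) t \<le> N
      else N < word_weight (\<lambda>x. x) (certain P') (d, 1) t"
    using assms(1) h unfolding separated_def list_all_iff by auto
  have m: "mono (\<lambda>x::nat. x)" by (simp add: mono_def)
  have "word_weight (\<lambda>x. x) (\<lambda>c. n dvd displacement c) (d, 1) t \<le> word_weight (\<lambda>x. x) (possible P) (d, 1) t"
    by (rule word_weight_mono[OF _ m]) (rule possibleI[OF P])
  moreover have "word_weight (\<lambda>x. x) (certain P') (d, 1) t \<le>
      word_weight (\<lambda>x. x) (\<lambda>c. n dvd displacement c) (d, 1) t"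
    by (rule word_weight_mono[OF _ m]) (rule certainD[OF P'])
  ultimately show "word_weight (\<lambda>x. x) (\<lambda>c. n dvd displacement c) (d, 1) t \<in> {..N} \<longleftrightarrow> d = fst t"
    using sep by (auto split: if_splits)
qed

lemma k_dvd_square: "k dvd A + B * r \<Longrightarrow> k dvd A * A - B * B"
proof -
  assume "k dvd A + B * r"
  moreover have "A * A - B * B = (A + B * r) * (A - B * r) + B * B * (r ^ 2 - 1)"
    by (simp add: power2_eq_square algebra_simps)
  ultimately show ?thesis using k_dvd by simp
qed

lemma k_dvd_even: "k dvd A + B * r \<Longrightarrow> even (A + B)"
  using even_k odd_r by (metis dvd_trans even_add even_mult_iff)

lemma coprime_k_r: "coprime k r"
proof -
  have "coprime (r ^ 1) n" by (rule power_mod_4_unit)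
  then show ?thesis by (simp add: n1_eq coprime_commute)
qed

lemma coprime_l_r: "coprime l r"
proof -
  have "coprime (r ^ 1) n" by (rule power_mod_4_unit)
  then show ?thesis by (simp add: n1_eq coprime_commute)
qed

lemma small_kI:
  assumes k: "k \<ge> 12" and ns: "\<not> k dvd 1 + r" "\<not> k dvd 1 - r" and AB: "k dvd A + B * r"
  shows "small_k A B"
proof -
  note sq = k_dvd_square[OF AB]
  have ge: "8 \<le> \<bar>x\<bar>" if "k dvd x" "x \<noteq> 0" for x
    using dvd_imp_le_int[OF that(2,1)] k by auto
  have "B = 0 \<or> 8 \<le> \<bar>B\<bar>" if "A = 0"
    using AB that ge[of B] coprime_k_r by (auto simp: coprime_dvd_mult_left_iff)
  moreover have "A = 0 \<or> 8 \<le> \<bar>A\<bar>" if "B = 0"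
    using AB that ge[of A] by auto
  moreover have "\<not> (\<bar>A\<bar> = 1 \<and> \<bar>B\<bar> = 1)"
  proof
    assume "\<bar>A\<bar> = 1 \<and> \<bar>B\<bar> = 1"
    then have "A + B * r = 1 + r \<or> A + B * r = 1 - r \<or> A + B * r = - (1 - r) \<or> A + B * r = - (1 + r)"
      by (auto simp: abs_if split: if_splits)
    then show False using AB ns by (metis dvd_minus_iff)
  qed
  \<comment> \<open>The absolute values 1 and 3 make \<open>A * A - B * B\<close> equal to 8 or
    -8.\<close>
  moreover have n8: "\<not> k dvd 8" "\<not> k dvd - 8"
    using k zdvd_imp_le[of k 8] by auto
  have sq': "k dvd \<bar>A\<bar> * \<bar>A\<bar> - \<bar>B\<bar> * \<bar>B\<bar>" using sq by simp
  moreover have "\<not> (\<bar>A\<bar> = 1 \<and> \<bar>B\<bar> = 3)"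
  proof
    assume h: "\<bar>A\<bar> = 1 \<and> \<bar>B\<bar> = 3"
    have "k dvd 1 * 1 - 3 * 3" using sq' unfolding h[THEN conjunct1] h[THEN conjunct2] .
    then show False using n8(2) by simp
  qed
  moreover have "\<not> (\<bar>A\<bar> = 3 \<and> \<bar>B\<bar> = 1)"
  proof
    assume h: "\<bar>A\<bar> = 3 \<and> \<bar>B\<bar> = 1"
    have "k dvd 3 * 3 - 1 * 1" using sq' unfolding h[THEN conjunct1] h[THEN conjunct2] .
    then show False using n8(1) by simp
  qed
  ultimately show ?thesis using k_dvd_even[OF AB] unfolding small_k_def by blast
qed

lemma small_lI:
  assumes l: "l \<ge> 13" and ab: "l dvd a + b * r"
  shows "small_l a b"
proof -
  have ge: "13 \<le> \<bar>x\<bar>" if "l dvd x" "x \<noteq> 0" for x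
    using dvd_imp_le_int[OF that(2,1)] l by auto
  show ?thesis
  proof (cases "a = 0 \<and> b = 0")
    case False
    then have pos: "0 < a * a + b * b" by (simp add: sum_squares_gt_zero_iff)
    have "l dvd a * a + b * b" using l_dvd_norm[OF ab] by (simp add: power2_eq_square)
    from ge[OF this less_imp_neq[OF pos, symmetric]] have "13 \<le> a * a + b * b" using pos by linarith
    moreover have "13 \<le> \<bar>b\<bar>" if "a = 0"
      using ab that False ge[of b] coprime_l_r by (auto simp: coprime_dvd_mult_left_iff)
    moreover have "13 \<le> \<bar>a\<bar>" if "b = 0" using ab that False ge[of a] by auto
    ultimately show ?thesis by (simp add: small_l_def)
  qed (simp add: small_l_def)
qed

text \<open>-1 is not a square modulo 3, 7, 9 or 11, which leaves 5 as the only odd number strictly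
  between 1 and 13.\<close>

lemma l_cases: "l = 5 \<or> l \<ge> 13"
proof -
  have no: "\<not> m dvd r ^ 2 + 1" if "list_all (\<lambda>x. (x * x + 1) mod m \<noteq> 0) [0..m - 1]" "m > 0" for m
  proof -
    have "r mod m \<in> set [0..m - 1]" using that(2) by simp
    then have "((r mod m) * (r mod m) + 1) mod m \<noteq> 0" using that(1) by (simp add: list_all_iff)
    moreover have "((r mod m) * (r mod m) + 1) mod m = (r * r + 1) mod m"
      by (metis mod_add_left_eq mod_mult_eq)
    ultimately have "(r * r + 1) mod m \<noteq> 0" by simp
    then show ?thesis by (simp add: power2_eq_square dvd_eq_mod_eq_0)
  qed
  have "\<not> 3 dvd r ^ 2 + 1" "\<not> 7 dvd r ^ 2 + 1" "\<not> 9 dvd r ^ 2 + 1" "\<not> 11 dvd r ^ 2 + 1"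
    by (rule no; code_simp)+
  then have "l \<noteq> 3" "l \<noteq> 7" "l \<noteq> 9" "l \<noteq> 11" using l_dvd by auto
  then show ?thesis using l_gt odd_l by presburger
qed

text \<open>Modulo 4, 6 and 10 the only square roots of 1 are 1 and -1.\<close>

lemma k_cases:
  assumes "\<not> k dvd 1 + r" "\<not> k dvd 1 - r"
  shows "k = 8 \<or> k \<ge> 12"
proof -
  have "k \<noteq> 4" using assms odd_r by (intro notI) (simp, presburger)
  moreover have "k \<noteq> 6"
  proof
    assume k: "k = 6"
    have "\<not> 3 dvd r"
    proof
      assume "3 dvd r"
      moreover have "3 dvd k" by (simp add: k)
      ultimately have "is_unit (3 :: int)" using coprime_common_divisor[OF coprime_k_r] by blast
      then show False by simp
    qed
    then show False using assms odd_r unfolding k by presburger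
  qed
  moreover have "k \<noteq> 10"
  proof
    assume k: "k = 10"
    have "5 dvd (r - 1) * (r + 1)"
      using dvd_trans[OF _ k_dvd, of 5] by (simp add: k power2_eq_square algebra_simps)
    then have "5 dvd r - 1 \<or> 5 dvd r + 1" using prime_dvd_mult_iff[of "5 :: int"] by simp
    then show False using assms odd_r unfolding k by presburger
  qed
  ultimately show ?thesis using k_gt even_k by presburger
qed

lemma r_mod_5:
  assumes "l = 5"
  shows "r mod 5 = 2 \<or> r mod 5 = 3"
proof -
  have squares: "list_all (\<lambda>x. (x * x + 1) mod 5 = 0 \<longrightarrow> x = 2 \<or> x = 3) [0..4 :: int]" by code_simp
  have range: "r mod 5 \<in> set [0..4]" by auto
  have "((r mod 5) * (r mod 5) + 1) mod 5 = 0"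
  proof -
    have "((r mod 5) * (r mod 5) + 1) mod 5 = (r * r + 1) mod 5"
      by (metis mod_add_left_eq mod_mult_eq)
    also have "\<dots> = 0"
      using l_dvd unfolding assms power2_eq_square by (rule dvd_imp_mod_0)
    finally show ?thesis .
  qed
  then show ?thesis by (rule squares[unfolded list_all_iff, THEN bspec, OF range, THEN mp])
qed

lemma dvd_mod_replace: "r mod m = q \<Longrightarrow> m dvd x + y * r \<longleftrightarrow> m dvd x + y * q"
proof -
  assume "r mod m = q"
  then have "[r = q] (mod m)" by (auto simp: cong_def)
  then have "[x + y * r = x + y * q] (mod m)" by (intro cong_add cong_mult cong_refl)
  then show ?thesis by (rule cong_dvd_iff)
qed

lemma not_arc_transitive_k8:
  assumes k: "k = 8" and l: "l \<ge> 13" and q: "r mod 8 = q"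
    and sep: "separated (possible (\<lambda>A B a b. small_l a b \<and> 8 dvd A + B * q))
      (certain (\<lambda>A B a b. 8 dvd A + B * q \<and> a = 0 \<and> b = 0)) 5"
  shows "\<not> arc_transitive X"
proof (rule not_arc_transitive_if_separated[OF sep])
  show "small_l a b \<and> 8 dvd A + B * q" if "k dvd A + B * r" "l dvd a + b * r" for A B a b
    using that small_lI[OF l] dvd_mod_replace[OF q] by (simp add: k)
  show "k dvd A + B * r \<and> l dvd a + b * r" if "8 dvd A + B * q \<and> a = 0 \<and> b = 0" for A B a b
    using that dvd_mod_replace[OF q] by (simp add: k)
qed

lemma not_arc_transitive_l5:
  assumes l: "l = 5" and k: "k \<ge> 12" and ns: "\<not> k dvd 1 + r" "\<not> k dvd 1 - r" and q: "r mod 5 = q"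
    and sep: "separated (possible (\<lambda>A B a b. 5 dvd a + b * q \<and> small_k A B \<and> \<not> (\<bar>A\<bar> = 2 \<and> B = A)))
        (certain (\<lambda>A B a b. 5 dvd a + b * q \<and> A = 0 \<and> B = 0)) 5"
      "separated (possible (\<lambda>A B a b. 5 dvd a + b * q \<and> small_k A B \<and> \<not> (\<bar>A\<bar> = 2 \<and> B = - A)))
        (certain (\<lambda>A B a b. 5 dvd a + b * q \<and> A = 0 \<and> B = 0)) 5"
  shows "\<not> arc_transitive X"
proof -
  have P': "k dvd A + B * r \<and> l dvd a + b * r" if "5 dvd a + b * q \<and> A = 0 \<and> B = 0" for A B a b
    using that dvd_mod_replace[OF q] by (simp add: l)
  have sk: "5 dvd a + b * q \<and> small_k A B" if "k dvd A + B * r" "l dvd a + b * r" for A B a b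
    using that small_kI[OF k ns] dvd_mod_replace[OF q] by (simp add: l)
  show ?thesis
  \<comment> \<open>\<open>k\<close> cannot divide both \<open>2 + 2 * r\<close> and
    \<open>2 - 2 * r\<close>, whose sum is 4; one that it does not divide justifies the additional
    exclusion in \<open>sep\<close>.\<close>
  proof (cases "k dvd 2 + 2 * r")
    case True
    have nk: "\<not> k dvd 2 - 2 * r"
    proof
      assume "k dvd 2 - 2 * r"
      from dvd_add[OF True this] have "k dvd 4" by simp
      then show False using k zdvd_imp_le[of k 4] by simp
    qed
    have "\<not> (\<bar>A\<bar> = 2 \<and> B = - A)" if "k dvd A + B * r" for A B
    proof
      assume "\<bar>A\<bar> = 2 \<and> B = - A"
      then have "A = 2 \<and> B = - 2 \<or> A = - 2 \<and> B = 2" by linarith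
      then have "A + B * r = 2 - 2 * r \<or> A + B * r = - (2 - 2 * r)" by auto
      then show False using that nk by (metis dvd_minus_iff)
    qed
    with sk show ?thesis by (intro not_arc_transitive_if_separated[OF sep(2) _ P']) auto
  next
    case False
    have "\<not> (\<bar>A\<bar> = 2 \<and> B = A)" if "k dvd A + B * r" for A B
    proof
      assume "\<bar>A\<bar> = 2 \<and> B = A"
      then have "A = 2 \<and> B = 2 \<or> A = - 2 \<and> B = - 2" by linarith
      then have "A + B * r = 2 + 2 * r \<or> A + B * r = - (2 + 2 * r)" by auto
      then show False using that False by (metis dvd_minus_iff)
    qed
    with sk show ?thesis by (intro not_arc_transitive_if_separated[OF sep(1) _ P']) auto
  qed
qed

text \<open>Here \<open>n = 80\<close>, and divisibility depends only on \<open>r mod 80\<close>, so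
  the weights are computed exactly instead of being bounded.\<close>

lemma not_arc_transitive_80:
  assumes n: "k = 8" "l = 5" and q: "r mod 80 = q" and sep: "separated_squares (divides_80 q)"
  shows "\<not> arc_transitive X"
proof (rule not_arc_transitive_if_weights[where f = "\<lambda>x. x * x" and W = "{34, 36}"])
  have n80: "n = 80" by (simp add: n n1_eq)
  have "divides_80 q c \<longleftrightarrow> n dvd displacement c" for c
  proof (cases c)
    case (fields c0 c1 c2 c3)
    have "[q = r] (mod 80)" using q by (auto simp: cong_def)
    then have "[c0 + q * (c1 + q * (c2 + q * c3)) = c0 + r * (c1 + r * (c2 + r * c3))] (mod 80)"
      by (intro cong_add cong_mult cong_refl)
    moreover have "c0 + r * (c1 + r * (c2 + r * c3)) = displacement c"
      by (simp add: fields power2_eq_square power3_eq_cube algebra_simps)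
    ultimately show ?thesis by (simp add: fields n80 cong_def dvd_eq_mod_eq_0)
  qed
  then have Q: "(\<lambda>c. n dvd displacement c) = divides_80 q" by blast
  fix d :: int and t assume h: "d \<in> {1, -1}" "t \<in> set steps" "(d, 1) \<noteq> t"
  show "word_weight (\<lambda>x. x * x) (\<lambda>c. n dvd displacement c) (d, 1) t \<in> {34, 36} \<longleftrightarrow> d = fst t"
    using sep h unfolding separated_squares_def list_all_iff Q by auto
qed

text \<open>The sign of \<open>r\<close> can be normalised modulo 8 or modulo 5, but in general not
  modulo both; for \<open>k = 8\<close> and \<open>l = 5\<close> this leaves four residues modulo
  80.\<close>

lemma not_arc_transitive_without_4_cycles:
  assumes ns: "\<not> k dvd 1 + r" "\<not> k dvd 1 - r"
    and r8: "k = 8 \<Longrightarrow> r mod 8 = 3" and r5: "k \<noteq> 8 \<Longrightarrow> l = 5 \<Longrightarrow> r mod 5 = 2"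
  shows "\<not> arc_transitive X"
proof -
  consider "k = 8" "l = 5" | "k = 8" "l \<ge> 13" | "k \<ge> 12" "l = 5" | "k \<ge> 12" "l \<ge> 13"
    using k_cases[OF ns] l_cases by blast
  then show ?thesis
  proof cases
    case 1
    have "r mod 80 \<in> {3, 27, 43, 67}"
    proof -
      have residues: "list_all (\<lambda>x. x mod 8 = 3 \<and> (x mod 5 = 2 \<or> x mod 5 = 3) \<longrightarrow>
        x \<in> {3, 27, 43, 67}) [0..79 :: int]" by code_simp
      have range: "r mod 80 \<in> set [0..79]" by auto
      have "r mod 80 mod 8 = r mod 8" "r mod 80 mod 5 = r mod 5" by (simp_all add: mod_mod_cancel)
      then show ?thesis
        using r8[OF 1(1)] r_mod_5[OF 1(2)]
        by (intro residues[unfolded list_all_iff, THEN bspec, OF range, THEN mp]) (simp only: simp_thms)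
    qed
    then consider "r mod 80 = 3" | "r mod 80 = 27" | "r mod 80 = 43" | "r mod 80 = 67" by blast
    then show ?thesis
      by cases (rule not_arc_transitive_80[OF 1], assumption,
        rule separated_80_3 separated_80_27 separated_80_43 separated_80_67)+
  next
    case 2
    show ?thesis by (rule not_arc_transitive_k8[OF 2 r8[OF 2(1)] separated_k8])
  next
    case 3
    have "r mod 5 = 2" using r5 3 by simp
    then show ?thesis
      by (rule not_arc_transitive_l5[OF 3(2,1) ns _ separated_l5_plus separated_l5_minus])
  next
    case 4
    show ?thesis
    proof (rule not_arc_transitive_if_separated[OF separated_generic])
      show "small_l a b \<and> small_k A B" if "k dvd A + B * r" "l dvd a + b * r" for A B a b
        using that small_lI[OF 4(2)] small_kI[OF 4(1) ns] by blast
    qed simp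
  qed
qed

theorem not_arc_transitive_factored: "\<not> arc_transitive X"
proof (cases "k dvd 1 + r \<or> k dvd 1 - r")
  case True
  then obtain s where s: "s \<in> {1, -1}" "k dvd 1 + s * r"
  proof
    assume "k dvd 1 + r"
    then show thesis using that[of 1] by simp
  next
    assume "k dvd 1 - r"
    then show thesis using that[of "-1"] by simp
  qed
  interpret four_cycle_component n1 r X vtx k l s
    by unfold_locales (use s in auto)
  show ?thesis by (rule not_arc_transitive)
next
  case False
  then have ns: "\<not> k dvd 1 + r" "\<not> k dvd 1 - r" by auto
  show ?thesis
  proof (cases "(k = 8 \<longrightarrow> r mod 8 = 3) \<and> (k \<noteq> 8 \<longrightarrow> l = 5 \<longrightarrow> r mod 5 = 2)")
    case True
    then show ?thesis by (intro not_arc_transitive_without_4_cycles[OF ns]) blast+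
  next
    case False
    \<comment> \<open>For \<open>- r\<close> the residue 5 modulo 8 becomes 3, and the residue 3
      modulo 5 becomes 2.\<close>
    interpret neg: metacirculant_component n1 "- r" X vtx by (rule uminus)
    interpret neg: factored_component n1 "- r" X vtx k l
      by unfold_locales (use n1_eq k_dvd l_dvd odd_l l_gt k_gt in simp_all)
    show ?thesis
    proof (rule neg.not_arc_transitive_without_4_cycles)
      show "\<not> k dvd 1 + - r" "\<not> k dvd 1 - - r" using ns by simp_all
      show "- r mod 8 = 3" if k8: "k = 8"
      proof -
        have "r mod 8 \<noteq> 3" using False k8 by simp
        moreover have "\<not> 8 dvd 1 + r" "\<not> 8 dvd 1 - r" using ns k8 by simp_all
        ultimately show ?thesis using odd_r by presburger
      qed
      show "- r mod 5 = 2" if "k \<noteq> 8" "l = 5"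
      proof -
        have "r mod 5 = 3" using False that r_mod_5 by simp
        then show ?thesis by presburger
      qed
    qed
  qed
qed

end

section \<open>The factorisation of \<open>n1\<close>\<close>

context metacirculant_component
begin

text \<open>Half of \<open>r ^ 2 + 1\<close> is an odd number \<open>w\<close> coprime to
  \<open>r ^ 2 - 1\<close>, and \<open>r ^ 4 = 1\<close> modulo \<open>2 * n1\<close> says that
  \<open>n1\<close> divides \<open>(r ^ 2 - 1) * w\<close>. So \<open>n1\<close> is the product of
  its greatest common divisors with the two factors.\<close>

lemma not_arc_transitive_if_square:
  assumes "\<not> [r ^ 2 = 1] (mod n1)" "\<not> [r ^ 2 = -1] (mod n1)"
  shows "\<not> arc_transitive X"
proof -
  obtain q where q: "r = 2 * q + 1" using odd_r by (rule oddE)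
  define w where "w = 2 * (q * (q + 1)) + 1"
  have r2: "r ^ 2 + 1 = 2 * w" "r ^ 2 - 1 = 2 * (w - 1)"
    by (simp_all add: q w_def power2_eq_square algebra_simps)
  have odd_w: "odd w" by (simp add: w_def)
  have cop: "coprime (r ^ 2 - 1) w"
  proof -
    have "coprime (w - 1) w" by (metis coprime_commute coprime_diff_one_left)
    moreover have "coprime 2 w" using odd_w by simp
    ultimately show ?thesis unfolding r2(2) coprime_mult_left_iff by blast
  qed
  define k l where "k = gcd n1 (r ^ 2 - 1)" and "l = gcd n1 w"
  have "2 * n1 dvd r ^ 4 - 1" using r4 by (simp add: cong_iff_dvd_diff)
  moreover have "r ^ 4 - 1 = 2 * ((r ^ 2 - 1) * w)"
  proof -
    have "r ^ 4 - 1 = (r ^ 2 - 1) * (r ^ 2 + 1)" by (simp add: numeral_eq_Suc algebra_simps)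
    then show ?thesis unfolding r2(1) by simp
  qed
  ultimately have "2 * n1 dvd 2 * ((r ^ 2 - 1) * w)" by (simp only:)
  then have dvd: "n1 dvd (r ^ 2 - 1) * w" unfolding dvd_mult_cancel_left by simp
  have ckl: "coprime k l"
    using coprime_divisors[OF _ _ cop] by (simp add: k_def l_def)
  have "k * l dvd n1" by (rule divides_mult) (use ckl in \<open>simp_all add: k_def l_def\<close>)
  moreover have "n1 dvd k * l"
  proof -
    obtain x y where xy: "n1 = x * y" "x dvd r ^ 2 - 1" "y dvd w" using division_decomp[OF dvd] by blast
    then have "x dvd k" "y dvd l" by (simp_all add: k_def l_def)
    then show ?thesis unfolding xy(1) by (rule mult_dvd_mono)
  qed
  moreover have "k > 0" "l > 0" using n1_pos by (simp_all add: k_def l_def)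
  ultimately have kl: "n1 = k * l" using n1_pos by (intro zdvd_antisym_nonneg) auto
  have k: "k dvd r ^ 2 - 1" and l: "l dvd w" by (simp_all add: k_def l_def)
  have odd_l: "odd l" using l odd_w dvd_trans by blast
  have "l \<noteq> 1"
  proof
    assume "l = 1"
    then have "[r ^ 2 = 1] (mod n1)" using k by (simp add: kl cong_iff_dvd_diff)
    then show False using assms(1) by simp
  qed
  \<comment> \<open>For \<open>k = 2\<close> the number \<open>n1 = 2 * l\<close> would divide
    \<open>2 * w = r ^ 2 + 1\<close>.\<close>
  have "k \<noteq> 2"
  proof
    assume "k = 2"
    then have "n1 dvd r ^ 2 + 1" using l by (simp add: kl r2)
    then show False using assms(2) by (simp add: cong_iff_dvd_diff)
  qed
  moreover have "even k" using even_n1 odd_l by (simp add: kl)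
  ultimately have "k > 2" using \<open>k > 0\<close> by presburger
  interpret factored_component n1 r X vtx k l
  proof unfold_locales
    show "l dvd r ^ 2 + 1" using l by (simp add: r2)
    show "l > 1" using \<open>l > 0\<close> \<open>l \<noteq> 1\<close> by simp
  qed (use kl k odd_l \<open>k > 2\<close> in auto)
  show ?thesis by (rule not_arc_transitive_factored)
qed

end

section \<open>The connected components\<close>

text \<open>Vertices for arbitrary integer indices, reduced to the representatives that
  \<open>metacirculant\<close> uses.\<close>

definition node :: "int \<Rightarrow> int \<Rightarrow> int \<Rightarrow> nat \<times> int" where
  "node N i j = (nat (i mod 4), j mod N)"

lemma node_eq_iff: "node N i j = node N i' j' \<longleftrightarrow> [i = i'] (mod 4) \<and> [j = j'] (mod N)"
  by (auto simp: node_def cong_def eq_nat_nat_iff)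

lemma node_parity:
  assumes "even n"
  shows "even (int (fst (node (int n) i j)) + snd (node (int n) i j)) \<longleftrightarrow> even (i + j)"
proof -
  have "even (i mod 4) \<longleftrightarrow> even i" "even (j mod int n) \<longleftrightarrow> even j"
    using assms by (simp_all add: dvd_mod_iff)
  then show ?thesis by (simp add: node_def)
qed

lemma pverts_metacirculant:
  assumes "n > 0"
  shows "pverts (metacirculant r 4 n) = {node (int n) i j | i j. True}"
proof -
  have "(i, j) = node (int n) (int i) j" if "i < 4" "0 \<le> j" "j < int n" for i j
    using that by (simp add: node_def)
  moreover have "node (int n) i j \<in> {0..<4} \<times> {0..<int n}" for i j
    using assms by (auto simp: node_def nat_less_iff)
  ultimately show ?thesis unfolding metacirculant_def by fastforce
qed

text \<open>A reversed upward step is a downward step with the same coefficient and the opposite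
  sign, so both halves of the arc relation take one form with a direction \<open>d\<close>.\<close>

lemma parcs_metacirculant:
  assumes n: "n > 0"
  shows "parcs (metacirculant r 4 n) =
    {(node (int n) i j, node (int n) (i + d) (j + e * step_coeff (int r) d i)) | i j d e.
      d \<in> {1, -1} \<and> e \<in> {1, -1}}" (is "?L = ?R")
proof -
  let ?up = "\<lambda>i j s. (node (int n) i j, node (int n) (i + 1) (j + s * step_coeff (int r) 1 i))"
  have up: "metacirculant_steps r 4 n = {?up i j s | i j s. s \<in> {1, -1}}"
  proof (intro equalityI subsetI)
    fix a assume "a \<in> metacirculant_steps r 4 n"
    then obtain i j s where h: "a = ((i, j), ((i + 1) mod 4, (j + s * int r ^ i) mod int n))"
      "i < 4" "0 \<le> j" "j < int n" "s \<in> {1, -1}"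
      unfolding metacirculant_steps_def by auto
    have "nat ((int i + 1) mod 4) = (i + 1) mod 4" by (simp add: nat_mod_distrib nat_add_distrib)
    then have "a = ?up (int i) j s" using h by (simp add: node_def step_coeff_def)
    then show "a \<in> {?up i j s | i j s. s \<in> {1, -1}}" using h(5) by blast
  next
    fix a assume "a \<in> {?up i j s | i j s. s \<in> {1, -1}}"
    then obtain i j s where h: "a = ?up i j s" "s \<in> {1, -1}" by blast
    define i' where "i' = nat (i mod 4)"
    have i': "i' < 4" "int i' = i mod 4" by (simp_all add: i'_def nat_less_iff)
    have "nat ((i + 1) mod 4) = (i' + 1) mod 4"
    proof -
      have "int ((i' + 1) mod 4) = (i + 1) mod 4" using i'(2) by (simp add: zmod_int mod_simps add.commute)
      then show ?thesis by simp
    qed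
    moreover have "(j + s * int r ^ i') mod int n = (j mod int n + s * int r ^ i') mod int n"
      by (simp add: mod_simps)
    ultimately have "a = ((i', j mod int n), ((i' + 1) mod 4, (j mod int n + s * int r ^ i') mod int n))"
      using h(1) by (simp add: node_def step_coeff_def i'_def)
    then show "a \<in> metacirculant_steps r 4 n"
      unfolding metacirculant_steps_def using i'(1) n h(2) by fastforce
  qed
  have down: "prod.swap (?up i j s) =
      (node (int n) (i + 1) (j + s * step_coeff (int r) 1 i),
       node (int n) (i + 1 + - 1) (j + s * step_coeff (int r) 1 i + - s * step_coeff (int r) (- 1) (i + 1)))" for i j s
    by (simp add: step_coeff_def)
  have down': "(node (int n) i j, node (int n) (i + - 1) (j + e * step_coeff (int r) (- 1) i)) =
      prod.swap (?up (i - 1) (j + e * step_coeff (int r) (- 1) i) (- e))" for i j e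
    by (simp add: step_coeff_def)
  have "?L = {?up i j s | i j s. s \<in> {1, -1}} \<union> prod.swap ` {?up i j s | i j s. s \<in> {1, -1}}"
  proof -
    have "R\<inverse> = prod.swap ` R" for R :: "(nat \<times> int) rel" by force
    then show ?thesis unfolding metacirculant_def up by simp
  qed
  also have "\<dots> = ?R"
  proof (intro equalityI subsetI)
    fix a assume "a \<in> {?up i j s | i j s. s \<in> {1, -1}} \<union> prod.swap ` {?up i j s | i j s. s \<in> {1, -1}}"
    then consider i j s where "s \<in> {1, -1}" "a = ?up i j s" | i j s where "s \<in> {1, -1}" "a = prod.swap (?up i j s)"
      by blast
    then show "a \<in> ?R"
    proof cases
      case 1
      then show ?thesis by blast
    next
      case (2 i j s)
      then have "- s \<in> {1, -1}" by auto
      then show ?thesis unfolding 2(2) down by blast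
    qed
  next
    fix a assume "a \<in> ?R"
    then obtain i j d e where h: "a = (node (int n) i j, node (int n) (i + d) (j + e * step_coeff (int r) d i))"
      "d \<in> {1, -1}" "e \<in> {1, -1}" by blast
    show "a \<in> {?up i j s | i j s. s \<in> {1, -1}} \<union> prod.swap ` {?up i j s | i j s. s \<in> {1, -1}}"
    proof (cases "d = 1")
      case True
      then show ?thesis using h by blast
    next
      case False
      then have d: "d = -1" using h(2) by simp
      have "- e \<in> {1, -1}" using h(3) by auto
      then show ?thesis unfolding h(1) d down' by blast
    qed
  qed
  finally show ?thesis .
qed

lemma pair_wf_digraph_metacirculant:
  assumes "n > 0"
  shows "pair_wf_digraph (metacirculant r 4 n)"
proof
  fix a assume "a \<in> parcs (metacirculant r 4 n)"
  then obtain i j d e where "a = (node (int n) i j, node (int n) (i + d) (j + e * step_coeff (int r) d i))"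
    unfolding parcs_metacirculant[OF assms] by blast
  then show "fst a \<in> pverts (metacirculant r 4 n)" "snd a \<in> pverts (metacirculant r 4 n)"
    unfolding pverts_metacirculant[OF assms] by auto
qed

text \<open>A step changes the level by 1 and the second coordinate by an odd number, and both
  moduli are even.\<close>

lemma reachable_parity:
  assumes n: "n > 0" "even n" and r: "odd r"
    and "u \<rightarrow>\<^sup>*\<^bsub>with_proj (metacirculant r 4 n)\<^esub> v"
  shows "even (int (fst u) + snd u) \<longleftrightarrow> even (int (fst v) + snd v)"
proof -
  interpret pair_wf_digraph "metacirculant r 4 n" by (rule pair_wf_digraph_metacirculant[OF n(1)])
  show ?thesis using assms(4)
  proof (induction rule: converse_reachable_induct)
    case (step u w)
    from step have "(u, w) \<in> parcs (metacirculant r 4 n)" by simp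
    then obtain i j d e where h: "u = node (int n) i j" "w = node (int n) (i + d) (j + e * step_coeff (int r) d i)"
      "d \<in> {1, -1}" "e \<in> {1, -1}" unfolding parcs_metacirculant[OF n(1)] by blast
    have "odd (step_coeff (int r) d i)" using r by (simp add: step_coeff_def)
    then have "even (i + d + (j + e * step_coeff (int r) d i)) \<longleftrightarrow> even (i + j)" using h(3,4) by auto
    with step(3) show ?case unfolding h(1,2) node_parity[OF n(2)] by blast
  qed simp_all
qed

text \<open>First climb to level \<open>i'\<close>. There, a step up followed by a step down with
  the same sign shifts by twice a unit, and repeating this reaches every even shift.\<close>

lemma reachable_same_parity:
  assumes n: "n > 0" "even n" and r4: "[int r ^ 4 = 1] (mod int n)" and r: "odd r"
    and par: "even (i + j) \<longleftrightarrow> even (i' + j')"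
  shows "node (int n) i j \<rightarrow>\<^sup>*\<^bsub>with_proj (metacirculant r 4 n)\<^esub> node (int n) i' j'"
proof -
  let ?M = "with_proj (metacirculant r 4 n)" and ?node = "node (int n)" and ?S = "step_coeff (int r)"
  interpret pair_wf_digraph "metacirculant r 4 n" by (rule pair_wf_digraph_metacirculant[OF n(1)])
  have step: "?node i j \<rightarrow>\<^sup>*\<^bsub>?M\<^esub> ?node (i + d) (j + e * ?S d i)" if "d \<in> {1, -1}" "e \<in> {1, -1}" for i j d e
    by (rule reachable_adjI) (use that n(1) in \<open>auto simp: parcs_metacirculant\<close>)
  have verts: "?node i j \<in> pverts (metacirculant r 4 n)" for i j
    unfolding pverts_metacirculant[OF n(1)] by blast
  have up: "\<exists>j'. ?node i j \<rightarrow>\<^sup>*\<^bsub>?M\<^esub> ?node (i + int t) j'" for i j t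
  proof (induction t)
    case 0
    show ?case using verts by (intro exI[of _ j]) auto
  next
    case (Suc t)
    have eq: "i + int t + 1 = i + int (Suc t)" by simp
    from Suc obtain j' where "?node i j \<rightarrow>\<^sup>*\<^bsub>?M\<^esub> ?node (i + int t) j'" by blast
    also have "?node (i + int t) j' \<rightarrow>\<^sup>*\<^bsub>?M\<^esub> ?node (i + int t + 1) (j' + 1 * ?S 1 (i + int t))"
      by (rule step) auto
    finally show ?case unfolding eq by blast
  qed
  have shift: "?node i j \<rightarrow>\<^sup>*\<^bsub>?M\<^esub> ?node i (j + 2 * int t * ?S 1 i)" for i j t
  proof (induction t)
    case 0
    show ?case using verts by auto
  next
    case (Suc t)
    let ?x = "j + 2 * int t * ?S 1 i"
    note Suc
    also have "?node i ?x \<rightarrow>\<^sup>*\<^bsub>?M\<^esub> ?node (i + 1) (?x + 1 * ?S 1 i)" by (rule step) auto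
    also have "?node (i + 1) (?x + 1 * ?S 1 i) \<rightarrow>\<^sup>*\<^bsub>?M\<^esub>
        ?node (i + 1 + - 1) (?x + 1 * ?S 1 i + 1 * ?S (- 1) (i + 1))" by (rule step) auto
    also have "?node (i + 1 + - 1) (?x + 1 * ?S 1 i + 1 * ?S (- 1) (i + 1)) = ?node i (j + 2 * int (Suc t) * ?S 1 i)"
      by (simp add: step_coeff_def algebra_simps)
    finally show ?case .
  qed
  obtain x where x: "?node i j \<rightarrow>\<^sup>*\<^bsub>?M\<^esub> ?node (i + int (nat ((i' - i) mod 4))) x" using up by blast
  moreover have "?node (i + int (nat ((i' - i) mod 4))) x = ?node i' x"
    by (simp add: node_eq_iff cong_def mod_simps)
  ultimately have x: "?node i j \<rightarrow>\<^sup>*\<^bsub>?M\<^esub> ?node i' x" by simp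
  have "even (i + j) \<longleftrightarrow> even (i' + x)"
    using reachable_parity[OF n r x] unfolding node_parity[OF n(2)] .
  then have "even (j' - x)" using par by auto
  then obtain q where q: "j' - x = 2 * q" by (rule evenE)
  define c where "c = ?S 1 i'"
  have c4: "[c ^ 4 = 1] (mod int n)"
  proof -
    have "c ^ 4 = (int r ^ 4) ^ nat (i' mod 4)"
      by (simp add: c_def step_coeff_def mult.commute flip: power_mult)
    also have "[\<dots> = 1 ^ nat (i' mod 4)] (mod int n)" by (rule cong_pow[OF r4])
    finally show ?thesis by simp
  qed
  \<comment> \<open>\<open>c ^ 3\<close> is inverse to \<open>c\<close>, so \<open>2 * t * c\<close>
    is the missing shift \<open>j' - x = 2 * q\<close> modulo \<open>n\<close>.\<close>
  define t where "t = nat ((q * c ^ 3) mod int n)"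
  have "[x + 2 * int t * c = x + 2 * (q * c ^ 3) * c] (mod int n)"
    using n(1) by (intro cong_add cong_mult cong_refl) (simp add: t_def)
  also have "x + 2 * (q * c ^ 3) * c = x + 2 * q * c ^ 4" by (simp add: numeral_eq_Suc)
  also have "[x + 2 * q * c ^ 4 = x + 2 * q * 1] (mod int n)" by (intro cong_add cong_mult cong_refl c4)
  also have "x + 2 * q * 1 = j'" using q by simp
  finally have "?node i' (x + 2 * int t * c) = ?node i' j'" by (simp add: node_eq_iff)
  then show ?thesis using reachable_trans[OF x shift[of i' x t]] by (simp add: c_def)
qed

text \<open>By the two reachability lemmas the vertices of a component are exactly those of one
  parity, and a shift of the second coordinate turns this parity into the even one.\<close>

lemma component_in_coordinates:
  assumes n1: "n1 > 0" "even n1" and n: "n = 2 * n1" and r4: "[int r ^ 4 = 1] (mod int n)" and r: "odd r"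
    and X: "X \<in> connected_components (metacirculant r 4 n)"
  shows "\<exists>p. metacirculant_component (int n1) (int r) X (\<lambda>i j. node (int n) i (j + p))"
proof -
  let ?M = "metacirculant r 4 n" and ?node = "node (int n)" and ?S = "step_coeff (int r)"
  have n0: "n > 0" "even n" using n1 n by auto
  interpret pair_wf_digraph ?M by (rule pair_wf_digraph_metacirculant[OF n0(1)])
  have scc: "with_proj X \<in> sccs" using X by (simp add: connected_components_def)
  have ind: "induced_subgraph (with_proj X) (with_proj ?M)" using scc by (auto simp: sccs_def)
  have arcs: "parcs X = {a \<in> parcs ?M. fst a \<in> pverts X \<and> snd a \<in> pverts X}"
    using ind by (auto simp: induced_subgraph_def)
  have "verts (with_proj X) \<in> sccs_verts" using scc by (intro in_sccs_vertsI_sccs) (rule imageI)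
  then have S: "pverts X \<in> sccs_verts" by simp
  then obtain u where u: "u \<in> pverts X" unfolding in_sccs_verts_conv_reachable by auto
  have sub: "pverts X \<subseteq> pverts ?M" using ind by (auto simp: induced_subgraph_def subgraph_def)
  then obtain i0 p where u0: "u = ?node i0 p" using u unfolding pverts_metacirculant[OF n0(1)] by blast
  have mem: "?node i j \<in> pverts X \<longleftrightarrow> (even (i + j) \<longleftrightarrow> even (i0 + p))" for i j
  proof
    assume "?node i j \<in> pverts X"
    then have "?node i j \<rightarrow>\<^sup>*\<^bsub>with_proj ?M\<^esub> u"
      using S u unfolding in_sccs_verts_conv_reachable by blast
    from reachable_parity[OF n0 r this] show "even (i + j) \<longleftrightarrow> even (i0 + p)"
      unfolding u0 node_parity[OF n0(2)] .
  next
    assume "even (i + j) \<longleftrightarrow> even (i0 + p)"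
    then have "?node i j \<rightarrow>\<^sup>*\<^bsub>with_proj ?M\<^esub> u" "u \<rightarrow>\<^sup>*\<^bsub>with_proj ?M\<^esub> ?node i j"
      unfolding u0 by (auto intro!: reachable_same_parity[OF n0 r4 r])
    then show "?node i j \<in> pverts X"
      using S u unfolding in_sccs_verts_conv_reachable by blast
  qed
  \<comment> \<open>With this shift, \<open>i + (j + q)\<close> has the parity of
    \<open>i0 + p\<close> exactly when \<open>i + j\<close> is even.\<close>
  define q where "q = i0 + p"
  have mem': "?node i (j + q) \<in> pverts X \<longleftrightarrow> even (i + j)" for i j
    unfolding mem q_def by auto
  show ?thesis
  proof (intro exI[of _ q], unfold_locales)
    show "int n1 > 0" "even (int n1)" using n1 by simp_all
    show "[int r ^ 4 = 1] (mod 2 * int n1)" using r4 by (simp add: n)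
    show "?node i (j + q) = ?node i' (j' + q) \<longleftrightarrow> [i = i'] (mod 4) \<and> [j = j'] (mod 2 * int n1)" for i j i' j'
      by (simp add: node_eq_iff n cong_add_rcancel)
    show "pverts X = {?node i (j + q) | i j. even (i + j)}"
    proof (intro equalityI subsetI)
      fix v assume v: "v \<in> pverts X"
      then obtain i j where "v = ?node i j" using sub unfolding pverts_metacirculant[OF n0(1)] by blast
      then have "v = ?node i ((j - q) + q)" by simp
      with v mem' show "v \<in> {?node i (j + q) | i j. even (i + j)}" by blast
    next
      fix v assume "v \<in> {?node i (j + q) | i j. even (i + j)}"
      then show "v \<in> pverts X" using mem' by blast
    qed
    show "parcs X = {(?node i (j + q), ?node (i + d) (j + e * ?S d i + q)) | i j d e.
      even (i + j) \<and> d \<in> {1, -1} \<and> e \<in> {1, -1}}"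
    proof (intro equalityI subsetI)
      fix a assume a: "a \<in> parcs X"
      then obtain i j d e where h: "a = (?node i j, ?node (i + d) (j + e * ?S d i))"
        "d \<in> {1, -1}" "e \<in> {1, -1}" unfolding arcs parcs_metacirculant[OF n0(1)] by blast
      have "?node i ((j - q) + q) \<in> pverts X" using a unfolding arcs by (simp add: h(1))
      then have ev: "even (i + (j - q))" by (simp only: mem')
      have "a = (?node i ((j - q) + q), ?node (i + d) ((j - q) + e * ?S d i + q))" by (simp add: h(1))
      then show "a \<in> {(?node i (j + q), ?node (i + d) (j + e * ?S d i + q)) | i j d e.
          even (i + j) \<and> d \<in> {1, -1} \<and> e \<in> {1, -1}}" using ev h(2,3) by blast
    next
      fix a assume "a \<in> {(?node i (j + q), ?node (i + d) (j + e * ?S d i + q)) | i j d e.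
          even (i + j) \<and> d \<in> {1, -1} \<and> e \<in> {1, -1}}"
      then obtain i j d e where h: "a = (?node i (j + q), ?node (i + d) (j + e * ?S d i + q))"
        "even (i + j)" "d \<in> {1, -1}" "e \<in> {1, -1}" by blast
      have "odd (?S d i)" using r by (simp add: step_coeff_def)
      then have ev: "even (i + d + (j + e * ?S d i))" using h(2-4) by auto
      have "a = (?node i (j + q), ?node (i + d) ((j + q) + e * ?S d i))"
        by (simp add: h(1) algebra_simps)
      then have "a \<in> parcs ?M" unfolding parcs_metacirculant[OF n0(1)] using h(3,4) by blast
      moreover have "fst a \<in> pverts X" "snd a \<in> pverts X" using mem' h(2) ev by (simp_all add: h(1))
      ultimately show "a \<in> parcs X" unfolding arcs by blast
    qed
  qed
qed

theorem corollary9p2: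
  fixes n1 n r :: nat and X :: "(nat \<times> int) pair_pre_digraph"
  assumes "n1 > 0" and "even n1"
    and "n = 2 * n1"
    and "r < n" and "coprime r n" and "ord n r = 4"
    and "X \<in> connected_components (metacirculant r 4 n)"
  shows "if [int r ^ 2 = 1] (mod int n1) \<or> [int r ^ 2 = -1] (mod int n1)
         then arc_transitive X
         else half_arc_transitive X"
proof -
  have n: "n > 0" "even n" using assms(1,3) by simp_all
  have r: "odd r"
  proof
    assume "even r"
    with n(2) have "is_unit (2 :: nat)" using coprime_common_divisor[OF assms(5)] by blast
    then show False by simp
  qed
  have "[r ^ ord n r = 1] (mod n)" using ord_works by blast
  then have "[int (r ^ 4) = int 1] (mod int n)" unfolding assms(6) by (simp only: cong_int_iff)
  then have r4: "[int r ^ 4 = 1] (mod int n)" by simp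
  obtain p where "metacirculant_component (int n1) (int r) X (\<lambda>i j. node (int n) i (j + p))"
    using component_in_coordinates[OF assms(1-3) r4 r assms(7)] by blast
  then interpret metacirculant_component "int n1" "int r" X "\<lambda>i j. node (int n) i (j + p)" .
  show ?thesis
    using arc_transitive_if[of 1] arc_transitive_if[of "-1"] not_arc_transitive_if_square
      vertex_transitive edge_transitive by (auto simp: half_arc_transitive_def)
qed

end
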